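(* Let $G=\mathrm{SL}(N+1,\mathbb{C})$, let $V,W$ be finite-dimensional complex rational representations of $G$, and let $v\in V\setminus\{0\}$, $w\in W\setminus\{0\}$. If the pair $(v,w)$ is K-stable, then there is an integer $m>0$ such that for every one-parameter subgroup $\lambda$ of $G$, $$m\,\bigl(w_\lambda(v)-w_\lambda(w)\bigr)\;\ge\; w_\lambda(v)-\deg(V)\,w_\lambda(I).$$
   Context: A representation is rational if all its matrix coefficients are regular functions on $G$. A one-parameter subgroup of $G$ is an algebraic homomorphism $\lambda:\mathbb{C}^*\to G$. For a nonzero vector $v$ in a rational representation, the weight $w_\lambda(v)$ is the unique integer such that $\lim_{t\to0}t^{-w_\lambda(v)}\lambda(t)v$ exists and is nonzero. Fix a maximal algebraic torus $T\subset G$ with character lattice $M_{\mathbb Z}=\mathrm{Hom}(T,\mathbb{C}^* )$ and $M_{\mathbb R}=M_{\mathbb Z}\otimes_{\mathbb Z}\mathbb{R}$. Decompose $V=\bigoplus_{a}V_a$ into $T$-weight spaces. For $0\ne v\in V$ the weight polytope $\mathcal N(v)\subset M_{\mathbb R}$ is the convex hull of those $a$ for which the component $v_a$ of $v$ in $V_a$ is nonzero. $\mathfrak{gl}=\mathfrak{gl}(N+1,\mathbb{C})$ is the space of $(N+1)\times(N+1)$ matrices with $G$ acting by left multiplication, and $I\in\mathfrak{gl}$ is the identity matrix; $\mathcal N(I)$ is a standard $N$-simplex containing the origin. The degree of $V$ is $$\deg(V)=\min\{k\in\mathbb{Z}\mid k>0,\ \mathcal N(v)\subset k\,\mathcal N(I)\text{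 for all }0\neq v\in V\}.$$ (Consequently $\deg(V)\,w_\lambda(I)\le w_\lambda(v)$ always.) The pair $(v,w)$ is K-semistable if $w_\lambda(w)\le w_\lambda(v)$ for every one-parameter subgroup $\lambda$ of $G$. It is K-stable if it is K-semistable and $w_\lambda(w)<w_\lambda(v)$ for every one-parameter subgroup $\lambda$ of $G$ with $\deg(V)\,w_\lambda(I)<w_\lambda(v)$. *)

theory Defs
  imports "HOL-Analysis.Analysis" "HOL-Analysis.Finite_Function_Topology"
begin

section \<open>Regular functions\<close>

text \<open>The complex algebra of functions generated by \<open>F\<close>.\<close>

inductive_set generated_algebra :: "('x \<Rightarrow> complex) set \<Rightarrow> ('x \<Rightarrow> complex) set"
  for F :: "('x \<Rightarrow> complex) set" where
  gen: "f \<in> F \<Longrightarrow> f \<in> generated_algebra F"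
| const: "(\<lambda>_. c) \<in> generated_algebra F"
| add: "f \<in> generated_algebra F \<Longrightarrow> g \<in> generated_algebra F \<Longrightarrow>
    (\<lambda>x. f x + g x) \<in> generated_algebra F"
| mult: "f \<in> generated_algebra F \<Longrightarrow> g \<in> generated_algebra F \<Longrightarrow>
    (\<lambda>x. f x * g x) \<in> generated_algebra F"

definition restricts_from :: "('x \<Rightarrow> complex) set \<Rightarrow> 'x set \<Rightarrow> ('x \<Rightarrow> complex) \<Rightarrow> bool" where
  "restricts_from F X f \<longleftrightarrow> (\<exists>p \<in> generated_algebra F. \<forall>x\<in>X. f x = p x)"

definition matrix_coords :: "(complex^'n^'n \<Rightarrow> complex) set" where
  "matrix_coords = {\<lambda>A. A $ i $ j | i j. True}"

text \<open>Regular functions on a Zariski closed set \<open>X\<close> of matrices: restrictions of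
  polynomials in the entries.  On \<open>SL\<close> no inverse of the determinant is needed.\<close>

abbreviation regular_on :: "(complex^'n^'n) set \<Rightarrow> (complex^'n^'n \<Rightarrow> complex) \<Rightarrow> bool" where
  "regular_on X f \<equiv> restricts_from matrix_coords X f"

definition zariski_closed :: "(complex^'n^'n) set \<Rightarrow> bool" where
  "zariski_closed X \<longleftrightarrow>
    (\<exists>P \<subseteq> generated_algebra matrix_coords. X = {A. \<forall>p\<in>P. p A = 0})"

text \<open>\<open>N + 1\<close> is \<open>CARD('n)\<close>.\<close>

definition SL :: "(complex^'n^'n) set" where
  "SL = {A. det A = 1}"

text \<open>Only the values on \<open>\<complex>\<^sup>*\<close> matter; the regular functions on \<open>\<complex>\<^sup>*\<close> are the Laurent polynomials.\<close>

definition one_parameter_subgroup :: "(complex \<Rightarrow> complex^'n^'n) \<Rightarrow> bool" where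
  "one_parameter_subgroup l \<longleftrightarrow>
    (\<forall>t\<in>-{0}. l t \<in> SL) \<and>
    (\<forall>s\<in>-{0}. \<forall>t\<in>-{0}. l (s * t) = l s ** l t) \<and>
    (\<forall>i j. restricts_from {\<lambda>t. t, inverse} (-{0}) (\<lambda>t. l t $ i $ j))"

section \<open>Rational representations\<close>

text \<open>A complex vector space is a type \<open>'v\<close> with a scalar multiplication \<open>s\<close>; linear functionals
  replace coordinates, and only the action of elements of \<open>SL\<close> matters.\<close>

abbreviation functional :: "(complex \<Rightarrow> 'v::ab_group_add \<Rightarrow> 'v) \<Rightarrow> ('v \<Rightarrow> complex) \<Rightarrow> bool" where
  "functional s \<phi> \<equiv> Vector_Spaces.linear s (*) \<phi>"

definition rational_representation ::
  "(complex \<Rightarrow> 'v::ab_group_add \<Rightarrow> 'v) \<Rightarrow> (complex^'n^'n \<Rightarrow> 'v \<Rightarrow> 'v) \<Rightarrow> bool" where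
  "rational_representation s act \<longleftrightarrow>
    (\<exists>B. finite_dimensional_vector_space s B) \<and>
    (\<forall>g\<in>SL. Vector_Spaces.linear s s (act g)) \<and>
    (\<forall>v. act (mat 1) v = v) \<and>
    (\<forall>g\<in>SL. \<forall>h\<in>SL. \<forall>v. act (g ** h) v = act g (act h v)) \<and>
    (\<forall>\<phi> v. functional s \<phi> \<longrightarrow> regular_on SL (\<lambda>g. \<phi> (act g v)))"

definition gl_scale :: "complex \<Rightarrow> complex^'n^'n \<Rightarrow> complex^'n^'n" where
  "gl_scale c A = (\<chi> i j. c * A $ i $ j)"

definition gl_act :: "complex^'n^'n \<Rightarrow> complex^'n^'n \<Rightarrow> complex^'n^'n" where
  "gl_act g A = g ** A"

text \<open>Convergence in the canonical topology of a finite-dimensional space, i.e. convergence of all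
  coordinates.\<close>

definition vector_tendsto ::
  "(complex \<Rightarrow> 'v::ab_group_add \<Rightarrow> 'v) \<Rightarrow> ('x \<Rightarrow> 'v) \<Rightarrow> 'v \<Rightarrow> 'x filter \<Rightarrow> bool" where
  "vector_tendsto s f l F \<longleftrightarrow> (\<forall>\<phi>. functional s \<phi> \<longrightarrow> ((\<lambda>x. \<phi> (f x)) \<longlongrightarrow> \<phi> l) F)"

definition weight ::
  "(complex \<Rightarrow> 'v::ab_group_add \<Rightarrow> 'v) \<Rightarrow> (complex^'n^'n \<Rightarrow> 'v \<Rightarrow> 'v)
    \<Rightarrow> (complex \<Rightarrow> complex^'n^'n) \<Rightarrow> 'v \<Rightarrow> int" where
  "weight s act l v =
    (THE k. \<exists>u. u \<noteq> 0 \<and> vector_tendsto s (\<lambda>t. s (t powi (- k)) (act (l t) v)) u (at 0))"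

section \<open>Maximal tori and characters\<close>

text \<open>\<open>(\<complex>\<^sup>*)\<^sup>r\<close> as sequences that equal \<open>1\<close> from position \<open>r\<close> on.\<close>

definition std_torus :: "nat \<Rightarrow> (nat \<Rightarrow> complex) set" where
  "std_torus r = {z. (\<forall>i<r. z i \<noteq> 0) \<and> (\<forall>i\<ge>r. z i = 1)}"

definition std_torus_coords :: "nat \<Rightarrow> ((nat \<Rightarrow> complex) \<Rightarrow> complex) set" where
  "std_torus_coords r = {\<lambda>z. z i | i. i < r} \<union> {\<lambda>z. inverse (z i) | i. i < r}"

text \<open>A closed subgroup of \<open>SL\<close> isomorphic, as an algebraic group, to some \<open>(\<complex>\<^sup>*)\<^sup>r\<close>.\<close>

definition algebraic_torus :: "(complex^'n^'n) set \<Rightarrow> bool" where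
  "algebraic_torus T \<longleftrightarrow> T \<subseteq> SL \<and> zariski_closed T \<and>
    (\<exists>r \<phi>. bij_betw \<phi> (std_torus r) T \<and>
      (\<forall>y\<in>std_torus r. \<forall>z\<in>std_torus r. \<phi> (\<lambda>i. y i * z i) = \<phi> y ** \<phi> z) \<and>
      (\<forall>i j. restricts_from (std_torus_coords r) (std_torus r) (\<lambda>z. \<phi> z $ i $ j)) \<and>
      (\<forall>k<r. regular_on T (\<lambda>A. inv_into (std_torus r) \<phi> A k)))"

definition maximal_torus :: "(complex^'n^'n) set \<Rightarrow> bool" where
  "maximal_torus T \<longleftrightarrow> algebraic_torus T \<and>
    (\<forall>T'. algebraic_torus T' \<and> T \<subseteq> T' \<longrightarrow> T' = T)"

text \<open>The character lattice \<open>Hom(T, \<complex>\<^sup>*)\<close>; characters are made extensional so that they are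
  determined by their values on \<open>T\<close>.  The group law is pointwise multiplication.\<close>

definition characters :: "(complex^'n^'n) set \<Rightarrow> (complex^'n^'n \<Rightarrow> complex) set" where
  "characters T = {a \<in> extensional T.
    (\<forall>t\<in>T. a t \<noteq> 0) \<and> (\<forall>x\<in>T. \<forall>y\<in>T. a (x ** y) = a x * a y) \<and> regular_on T a}"

definition char_mult ::
  "(complex^'n^'n) set \<Rightarrow> (complex^'n^'n \<Rightarrow> complex) \<Rightarrow> (complex^'n^'n \<Rightarrow> complex)
    \<Rightarrow> (complex^'n^'n \<Rightarrow> complex)" where
  "char_mult T a b = (\<lambda>t\<in>T. a t * b t)"

text \<open>The space \<open>Hom(T, \<complex>\<^sup>*) \<otimes> \<real>\<close> is the free real vector space on the characters modulo the
  span of \<open>[a b] - [a] - [b]\<close>; its elements are represented as cosets.\<close>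

definition tensor_relations ::
  "(complex^'n^'n) set \<Rightarrow> (complex^'n^'n \<Rightarrow> complex, real) poly_mapping set" where
  "tensor_relations T = span {Poly_Mapping.single (char_mult T a b) 1
      - Poly_Mapping.single a 1 - Poly_Mapping.single b 1 | a b.
      a \<in> characters T \<and> b \<in> characters T}"

definition tensor_class ::
  "(complex^'n^'n) set \<Rightarrow> (complex^'n^'n \<Rightarrow> complex, real) poly_mapping
    \<Rightarrow> (complex^'n^'n \<Rightarrow> complex, real) poly_mapping set" where
  "tensor_class T x = (\<lambda>r. x + r) ` tensor_relations T"

section \<open>Weight polytopes and the degree\<close>

definition weight_space ::
  "(complex^'n^'n) set \<Rightarrow> (complex \<Rightarrow> 'v::ab_group_add \<Rightarrow> 'v) \<Rightarrow> (complex^'n^'n \<Rightarrow> 'v \<Rightarrow> 'v)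
    \<Rightarrow> (complex^'n^'n \<Rightarrow> complex) \<Rightarrow> 'v set" where
  "weight_space T s act a = {v. \<forall>t\<in>T. act t v = s (a t) v}"

text \<open>The family of components of \<open>v\<close> in the decomposition into weight spaces.\<close>

definition weight_components ::
  "(complex^'n^'n) set \<Rightarrow> (complex \<Rightarrow> 'v::ab_group_add \<Rightarrow> 'v) \<Rightarrow> (complex^'n^'n \<Rightarrow> 'v \<Rightarrow> 'v)
    \<Rightarrow> 'v \<Rightarrow> (complex^'n^'n \<Rightarrow> complex) \<Rightarrow> 'v" where
  "weight_components T s act v = (THE u.
    (\<forall>a\<in>characters T. u a \<in> weight_space T s act a) \<and> (\<forall>a. a \<notin> characters T \<longrightarrow> u a = 0) \<and>
    finite {a. u a \<noteq> 0} \<and> v = (\<Sum>a | u a \<noteq> 0. u a))"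

text \<open>The convex hull is taken in the free space before passing to cosets, which is the same as
  the convex hull in the quotient.\<close>

definition weight_polytope ::
  "(complex^'n^'n) set \<Rightarrow> (complex \<Rightarrow> 'v::ab_group_add \<Rightarrow> 'v) \<Rightarrow> (complex^'n^'n \<Rightarrow> 'v \<Rightarrow> 'v)
    \<Rightarrow> 'v \<Rightarrow> (complex^'n^'n \<Rightarrow> complex, real) poly_mapping set set" where
  "weight_polytope T s act v = tensor_class T `
    (convex hull {Poly_Mapping.single a 1 | a. weight_components T s act v a \<noteq> 0})"

text \<open>Dilation by \<open>c \<noteq> 0\<close> of a set of cosets.\<close>

definition dilate :: "real \<Rightarrow> 'a::real_vector set set \<Rightarrow> 'a set set" where
  "dilate c P = (\<lambda>X. (\<lambda>x. c *\<^sub>R x) ` X) ` P"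

definition rep_degree ::
  "(complex^'n^'n) set \<Rightarrow> (complex \<Rightarrow> 'v::ab_group_add \<Rightarrow> 'v) \<Rightarrow> (complex^'n^'n \<Rightarrow> 'v \<Rightarrow> 'v)
    \<Rightarrow> int" where
  "rep_degree T s act = (LEAST k::int. 0 < k \<and> (\<forall>v. v \<noteq> 0 \<longrightarrow>
    weight_polytope T s act v
      \<subseteq> dilate (real_of_int k) (weight_polytope T gl_scale gl_act (mat 1))))"

section \<open>K-stability\<close>

definition K_semistable ::
  "(complex \<Rightarrow> 'v::ab_group_add \<Rightarrow> 'v) \<Rightarrow> (complex^'n^'n \<Rightarrow> 'v \<Rightarrow> 'v) \<Rightarrow> 'v
    \<Rightarrow> (complex \<Rightarrow> 'w::ab_group_add \<Rightarrow> 'w) \<Rightarrow> (complex^'n^'n \<Rightarrow> 'w \<Rightarrow> 'w) \<Rightarrow> 'w \<Rightarrow> bool" where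
  "K_semistable sV actV v sW actW w \<longleftrightarrow>
    (\<forall>l. one_parameter_subgroup l \<longrightarrow> weight sW actW l w \<le> weight sV actV l v)"

definition K_stable ::
  "(complex^'n^'n) set
    \<Rightarrow> (complex \<Rightarrow> 'v::ab_group_add \<Rightarrow> 'v) \<Rightarrow> (complex^'n^'n \<Rightarrow> 'v \<Rightarrow> 'v) \<Rightarrow> 'v
    \<Rightarrow> (complex \<Rightarrow> 'w::ab_group_add \<Rightarrow> 'w) \<Rightarrow> (complex^'n^'n \<Rightarrow> 'w \<Rightarrow> 'w) \<Rightarrow> 'w \<Rightarrow> bool" where
  "K_stable T sV actV v sW actW w \<longleftrightarrow>
    K_semistable sV actV v sW actW w \<and>
    (\<forall>l. one_parameter_subgroup l \<and>
        rep_degree T sV actV * weight gl_scale gl_act l (mat 1) < weight sV actV l v \<longrightarrow>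
      weight sW actW l w < weight sV actV l v)"

end

theory Submission
  imports Defs
begin

text \<open>
  A one-parameter subgroup is diagonalizable, \<open>l t = g diag(t\<^sup>a) g\<^sup>-\<^sup>1\<close> with an integer vector
  \<open>a\<close> of sum \<open>0\<close>, and the weight of \<open>v\<close> along it is the minimum of \<open>\<langle>\<kappa>, a\<rangle>\<close> over the support of
  \<open>g\<^sup>-\<^sup>1 v\<close> with respect to the diagonal torus.  Only finitely many supports occur as \<open>g\<close> varies,
  although there are infinitely many \<open>g\<close>.  For fixed supports of \<open>v\<close>, \<open>w\<close> and \<open>I\<close> the space of all
  \<open>a\<close> is a finite union of cones on which the three minima are additive, say with differences
  \<open>f = w(v) - w(w)\<close> and \<open>h = w(v) - d w(I)\<close>.  K-stability says that on such a cone \<open>f \<ge> 0\<close>, and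
  \<open>f > 0\<close> where \<open>h > 0\<close>; Dickson's lemma, applied to the lattice points of the cone, turns this
  into \<open>h \<le> m f\<close>.
\<close>

section \<open>Characters and isotypic decompositions\<close>

text \<open>The form that regular functions take on a diagonalizable group when \<open>X\<close>
  consists of its algebraic characters. Equality is asked on \<open>G\<close> only, matching
  \<open>restricts_from\<close>.\<close>

definition character_combination ::
  "('g \<Rightarrow> complex) set \<Rightarrow> 'g set \<Rightarrow> ('g \<Rightarrow> complex) \<Rightarrow> bool" where
  "character_combination X G f \<longleftrightarrow>
    (\<exists>K c. finite K \<and> K \<subseteq> X \<and> (\<forall>z\<in>G. f z = (\<Sum>\<theta>\<in>K. c \<theta> * \<theta> z)))"

lemma character_combination_scaled:
  assumes "\<theta> \<in> X" "\<And>z. z \<in> G \<Longrightarrow> f z = c * \<theta> z"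
  shows "character_combination X G f"
  unfolding character_combination_def using assms
  by (intro exI[of _ "{\<theta>}"] exI[of _ "\<lambda>_. c"]) auto

lemma character_combination_zero: "character_combination X G (\<lambda>_. 0)"
  unfolding character_combination_def by (intro exI[of _ "{}"]) auto

lemma character_combination_add:
  assumes "character_combination X G f" "character_combination X G g"
  shows "character_combination X G (\<lambda>z. f z + g z)"
proof -
  obtain K c where K: "finite K" "K \<subseteq> X" "\<And>z. z \<in> G \<Longrightarrow> f z = (\<Sum>\<theta>\<in>K. c \<theta> * \<theta> z)"
    using assms(1) by (auto simp: character_combination_def)
  obtain L d where L: "finite L" "L \<subseteq> X" "\<And>z. z \<in> G \<Longrightarrow> g z = (\<Sum>\<theta>\<in>L. d \<theta> * \<theta> z)"
    using assms(2) by (auto simp: character_combination_def)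
  \<comment> \<open>The coefficients \<open>c\<close> and \<open>d\<close> are arbitrary off
    \<open>K\<close> and \<open>L\<close>, so they are cut to zero there before both sums are
    extended to \<open>K \<union> L\<close>.\<close>
  define e where "e \<theta> = (if \<theta> \<in> K then c \<theta> else 0) + (if \<theta> \<in> L then d \<theta> else 0)" for \<theta>
  have "f z + g z = (\<Sum>\<theta>\<in>K \<union> L. e \<theta> * \<theta> z)" if "z \<in> G" for z
  proof -
    have "(\<Sum>\<theta>\<in>K. c \<theta> * \<theta> z) = (\<Sum>\<theta>\<in>K \<union> L. (if \<theta> \<in> K then c \<theta> else 0) * \<theta> z)"
      using K(1) L(1) by (intro sum.mono_neutral_cong_left) auto
    moreover have "(\<Sum>\<theta>\<in>L. d \<theta> * \<theta> z) = (\<Sum>\<theta>\<in>K \<union> L. (if \<theta> \<in> L then d \<theta> else 0) * \<theta> z)"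
      using K(1) L(1) by (intro sum.mono_neutral_cong_left) auto
    ultimately show ?thesis
      using K(3)[OF that] L(3)[OF that] by (simp add: e_def distrib_right sum.distrib)
  qed
  then show ?thesis
    unfolding character_combination_def using K L
    by (intro exI[of _ "K \<union> L"] exI[of _ e]) auto
qed

lemma character_combination_sum:
  assumes "\<And>i. i \<in> I \<Longrightarrow> character_combination X G (f i)"
  shows "character_combination X G (\<lambda>z. \<Sum>i\<in>I. f i z)"
  using assms
  by (induction I rule: infinite_finite_induct)
     (auto intro: character_combination_zero character_combination_add)

lemma character_combination_cong:
  assumes "character_combination X G g" "\<And>z. z \<in> G \<Longrightarrow> f z = g z"
  shows "character_combination X G f"
  using assms by (auto simp: character_combination_def)

lemma character_combination_mult:
  assumes "\<And>\<theta> \<psi>. \<theta> \<in> X \<Longrightarrow> \<psi> \<in> X \<Longrightarrow> (\<lambda>z. \<theta> z * \<psi> z) \<in> X"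
    and "character_combination X G f" "character_combination X G g"
  shows "character_combination X G (\<lambda>z. f z * g z)"
proof -
  obtain K c where K: "finite K" "K \<subseteq> X" "\<And>z. z \<in> G \<Longrightarrow> f z = (\<Sum>\<theta>\<in>K. c \<theta> * \<theta> z)"
    using assms(2) by (auto simp: character_combination_def)
  obtain L d where L: "finite L" "L \<subseteq> X" "\<And>z. z \<in> G \<Longrightarrow> g z = (\<Sum>\<theta>\<in>L. d \<theta> * \<theta> z)"
    using assms(3) by (auto simp: character_combination_def)
  \<comment> \<open>Different pairs may have the same product, so the double sum is assembled term
    by term instead of being indexed by the set of products.\<close>
  have "character_combination X G (\<lambda>z. \<Sum>\<theta>\<in>K. \<Sum>\<psi>\<in>L. (c \<theta> * d \<psi>) * (\<theta> z * \<psi> z))"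
  proof (intro character_combination_sum)
    fix \<theta> \<psi> assume "\<theta> \<in> K" "\<psi> \<in> L"
    then have "(\<lambda>z. \<theta> z * \<psi> z) \<in> X" using assms(1) K(2) L(2) by blast
    then show "character_combination X G (\<lambda>z. (c \<theta> * d \<psi>) * (\<theta> z * \<psi> z))"
      by (intro character_combination_scaled[where \<theta> = "\<lambda>z. \<theta> z * \<psi> z" and c = "c \<theta> * d \<psi>"]) simp_all
  qed
  then show ?thesis
    by (rule character_combination_cong) (simp add: K(3) L(3) sum_product mult_ac)
qed

text \<open>Closure of \<open>X\<close> under products carries the property from the generators to
  the whole algebra, and a member equal to 1 on \<open>G\<close> covers the constants. The map
  \<tau> is the substitution that pulls functions back to \<open>G\<close>.\<close>

lemma generated_algebra_character_combination:
  assumes "p \<in> generated_algebra F"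
    and "\<And>f. f \<in> F \<Longrightarrow> character_combination X G (\<lambda>z. f (\<tau> z))"
    and one: "\<theta> \<in> X" "\<And>z. z \<in> G \<Longrightarrow> \<theta> z = 1"
    and mult: "\<And>\<theta> \<psi>. \<theta> \<in> X \<Longrightarrow> \<psi> \<in> X \<Longrightarrow> (\<lambda>z. \<theta> z * \<psi> z) \<in> X"
  shows "character_combination X G (\<lambda>z. p (\<tau> z))"
  using assms(1)
proof induction
  case (const c)
  show ?case using one by (intro character_combination_scaled[of \<theta> X G _ c]) auto
next
  case (mult p q)
  then show ?case by (intro character_combination_mult[OF assms(5)])
qed (simp_all add: assms(2) character_combination_add)

text \<open>Outside \<open>G\<close> the functions are \<open>0\<close>, so distinct characters differ at a point of \<open>G\<close>.\<close>

definition multiplicative_characters :: "'g::monoid_mult set \<Rightarrow> ('g \<Rightarrow> complex) set" where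
  "multiplicative_characters G = {\<theta>. \<theta> 1 = 1 \<and> (\<forall>z\<in>G. \<forall>w\<in>G. \<theta> (z * w) = \<theta> z * \<theta> w) \<and>
    (\<forall>z. z \<notin> G \<longrightarrow> \<theta> z = 0)}"


text \<open>Dedekind's argument with vector coefficients: subtracting \<open>\<theta>0 w\<close>
  times the relation at \<open>z\<close> from the relation at \<open>z * w\<close> eliminates
  \<theta>0 and leaves a shorter relation.\<close>

lemma characters_independent:
  fixes s :: "complex \<Rightarrow> 'v::ab_group_add \<Rightarrow> 'v" and G :: "'g::monoid_mult set"
  assumes vs: "vector_space s" and one: "1 \<in> G" and mult: "\<And>z w. z \<in> G \<Longrightarrow> w \<in> G \<Longrightarrow> z * w \<in> G"
    and "finite K" "K \<subseteq> multiplicative_characters G"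
    and "\<And>z. z \<in> G \<Longrightarrow> (\<Sum>\<theta>\<in>K. s (\<theta> z) (u \<theta>)) = 0"
    and "\<theta> \<in> K"
  shows "u \<theta> = 0"
proof -
  interpret vector_space s by (rule vs)
  have "\<forall>\<theta>\<in>K. u \<theta> = 0"
    using assms(4-6)
  proof (induction K arbitrary: u)
    case empty
    show ?case by simp
  next
    case (insert \<theta>0 K)
    have zero: "u \<theta> = 0" if \<theta>: "\<theta> \<in> K" for \<theta>
    proof -
      have "\<theta> \<noteq> \<theta>0" using \<theta> insert.hyps by auto
      then obtain w where w: "\<theta> w \<noteq> \<theta>0 w" by auto
      \<comment> \<open>Both functions vanish outside \<open>G\<close>, so a point that separates
        them lies in \<open>G\<close>.\<close>
      with insert.prems(1) \<theta> have wG: "w \<in> G"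
        by (fastforce simp: multiplicative_characters_def)
      have "(\<Sum>\<psi>\<in>K. s (\<psi> z) (s (\<psi> w - \<theta>0 w) (u \<psi>))) = 0" if z: "z \<in> G" for z
      proof -
        have a: "(\<Sum>\<psi>\<in>insert \<theta>0 K. s (\<psi> (z * w)) (u \<psi>)) = 0"
          using insert.prems(2) mult z wG by blast
        have b: "(\<Sum>\<psi>\<in>insert \<theta>0 K. s (\<theta>0 w) (s (\<psi> z) (u \<psi>))) = 0"
          using insert.prems(2)[OF z] by (metis scale_sum_right scale_zero_right)
        have "(\<Sum>\<psi>\<in>K. s (\<psi> z) (s (\<psi> w - \<theta>0 w) (u \<psi>)))
            = (\<Sum>\<psi>\<in>insert \<theta>0 K. s (\<psi> z) (s (\<psi> w - \<theta>0 w) (u \<psi>)))"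
          using insert.hyps by simp
        also have "\<dots> = (\<Sum>\<psi>\<in>insert \<theta>0 K. s (\<psi> (z * w)) (u \<psi>) - s (\<theta>0 w) (s (\<psi> z) (u \<psi>)))"
          using insert.prems(1) z wG
          by (intro sum.cong refl)
             (auto simp: multiplicative_characters_def subset_iff scale_left_diff_distrib
               algebra_simps)
        also have "\<dots> = 0" using a b by (simp only: sum_subtractf) simp
        finally show ?thesis .
      qed
      then have "\<forall>\<psi>\<in>K. s (\<psi> w - \<theta>0 w) (u \<psi>) = 0"
        using insert.IH[of "\<lambda>\<psi>. s (\<psi> w - \<theta>0 w) (u \<psi>)"] insert.prems(1) by blast
      with \<theta> w show ?thesis by auto
    qed
    \<comment> \<open>Evaluation at the unit, where \<theta>0 is 1, isolates the one remaining
      coefficient.\<close>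
    have "(\<Sum>\<psi>\<in>insert \<theta>0 K. s (\<psi> 1) (u \<psi>)) = 0"
      using insert.prems(2) one by blast
    moreover have "(\<Sum>\<psi>\<in>K. s (\<psi> 1) (u \<psi>)) = 0" using zero by (simp add: sum.neutral)
    moreover have "\<theta>0 1 = 1" using insert.prems(1) by (auto simp: multiplicative_characters_def)
    ultimately have "u \<theta>0 = 0" using insert.hyps by simp
    with zero show ?case by auto
  qed
  with assms(7) show ?thesis by blast
qed

section \<open>Simultaneous eigenvectors from characters\<close>

lemma functional_representation:
  assumes "finite_dimensional_vector_space s B" "b \<in> B"
  shows "functional s (\<lambda>x. module.representation s B x b)"
proof -
  interpret finite_dimensional_vector_space s B by fact
  have c: "vector_space ((*) :: complex \<Rightarrow> complex \<Rightarrow> complex)"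
    by unfold_locales (auto simp: algebra_simps)
  show ?thesis
    unfolding Vector_Spaces.linear_iff
    using vector_space_axioms c
    by (simp add: representation_add representation_scale independent_Basis span_Basis)
qed

text \<open>Collecting the matrix coefficients by character writes \<open>act z x\<close> as a sum
  of \<open>s (\<theta> z) (y \<theta> x)\<close>. At the unit this decomposes \<open>x\<close>;
  independence of characters shows that each part is an eigenvector. It serves both the diagonal
  torus on a representation and the punctured plane acting through a one-parameter subgroup.\<close>

lemma isotypic_decomposition:
  fixes s :: "complex \<Rightarrow> 'v::ab_group_add \<Rightarrow> 'v" and G :: "'g::monoid_mult set"
    and act :: "'g \<Rightarrow> 'v \<Rightarrow> 'v"
  assumes fd: "finite_dimensional_vector_space s B"
    and one: "1 \<in> G" and mult: "\<And>z w. z \<in> G \<Longrightarrow> w \<in> G \<Longrightarrow> z * w \<in> G"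
    and lin: "\<And>z. z \<in> G \<Longrightarrow> Vector_Spaces.linear s s (act z)"
    and act_one: "\<And>x. act 1 x = x"
    and act_mult: "\<And>z w x. z \<in> G \<Longrightarrow> w \<in> G \<Longrightarrow> act (z * w) x = act z (act w x)"
    and X: "X \<subseteq> multiplicative_characters G"
    and comb: "\<And>\<phi> x. functional s \<phi> \<Longrightarrow> character_combination X G (\<lambda>z. \<phi> (act z x))"
  shows "\<exists>K c. finite K \<and> K \<subseteq> X \<and> (\<forall>x. x = (\<Sum>\<theta>\<in>K. c \<theta> x) \<and>
    (\<forall>\<theta>\<in>K. \<forall>z\<in>G. act z (c \<theta> x) = s (\<theta> z) (c \<theta> x)))"
proof -
  interpret finite_dimensional_vector_space s B by (rule fd)
  let ?r = "\<lambda>x b. representation B x b"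
  define P where "P b b' K c \<longleftrightarrow> finite K \<and> K \<subseteq> X \<and>
      (\<forall>z\<in>G. ?r (act z b') b = (\<Sum>\<theta>\<in>K. c \<theta> * \<theta> z))" for b b' K c
  have "\<exists>K c. P b b' K c" if "b \<in> B" for b b'
    using comb[OF functional_representation[OF fd that], of b']
    by (simp only: character_combination_def P_def)
  then obtain L c where P: "\<And>b b'. b \<in> B \<Longrightarrow> P b b' (L b b') (c b b')"
    by metis
  have L: "finite (L b b')" "L b b' \<subseteq> X"
    "z \<in> G \<Longrightarrow> ?r (act z b') b = (\<Sum>\<theta>\<in>L b b'. c b b' \<theta> * \<theta> z)" if "b \<in> B" for b b' z
    using P[OF that, of b'] by (simp_all add: P_def)
  \<comment> \<open>Only pairs of basis vectors enter, so one finite set of characters serves all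
    \<open>x\<close>.\<close>
  define K where "K = (\<Union>b\<in>B. \<Union>b'\<in>B. L b b')"
  have finK: "finite K" using L(1) finite_Basis by (auto simp: K_def)
  have KX: "K \<subseteq> X" using L(2) by (auto simp: K_def)
  define d where "d b b' \<theta> = (if \<theta> \<in> L b b' then c b b' \<theta> else 0)" for b b' \<theta>
  \<comment> \<open>The vector coefficient of \<theta> in the function sending \<open>z\<close> to
    \<open>act z x\<close>.\<close>
  define y where "y \<theta> x = (\<Sum>b'\<in>B. \<Sum>b\<in>B. s (?r x b' * d b b' \<theta>) b)" for \<theta> x
  have rep: "x = (\<Sum>b\<in>B. s (?r x b) b)" for x
    using sum_representation_eq[of B x B] independent_Basis span_Basis finite_Basis by simp
  have coeff: "?r (act z b') b = (\<Sum>\<theta>\<in>K. d b b' \<theta> * \<theta> z)" if "b \<in> B" "b' \<in> B" "z \<in> G" for b b' z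
    unfolding L(3)[OF that(1) that(3)]
    using that finK by (intro sum.mono_neutral_cong_left) (auto simp: d_def K_def)
  have expand: "act z x = (\<Sum>\<theta>\<in>K. s (\<theta> z) (y \<theta> x))" if z: "z \<in> G" for z x
  proof -
    interpret lz: Vector_Spaces.linear s s "act z" by (rule lin[OF z])
    have "act z x = act z (\<Sum>b'\<in>B. s (?r x b') b')" using rep[of x] by simp
    also have "\<dots> = (\<Sum>b'\<in>B. s (?r x b') (act z b'))" by (simp add: lz.sum lz.scale)
    also have "\<dots> = (\<Sum>b'\<in>B. s (?r x b') (\<Sum>b\<in>B. s (\<Sum>\<theta>\<in>K. d b b' \<theta> * \<theta> z) b))"
    proof (intro sum.cong refl arg_cong2[where f = s])
      fix b' assume b': "b' \<in> B"
      show "act z b' = (\<Sum>b\<in>B. s (\<Sum>\<theta>\<in>K. d b b' \<theta> * \<theta> z) b)"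
        by (subst rep[of "act z b'"]) (simp add: coeff b' z)
    qed
    also have "\<dots> = (\<Sum>b'\<in>B. \<Sum>b\<in>B. \<Sum>\<theta>\<in>K. s (\<theta> z) (s (?r x b' * d b b' \<theta>) b))"
      by (simp add: scale_sum_right scale_sum_left mult_ac)
    also have "\<dots> = (\<Sum>b'\<in>B. \<Sum>\<theta>\<in>K. \<Sum>b\<in>B. s (\<theta> z) (s (?r x b' * d b b' \<theta>) b))"
      by (intro sum.cong refl sum.swap)
    also have "\<dots> = (\<Sum>\<theta>\<in>K. \<Sum>b'\<in>B. \<Sum>b\<in>B. s (\<theta> z) (s (?r x b' * d b b' \<theta>) b))"
      by (rule sum.swap)
    also have "\<dots> = (\<Sum>\<theta>\<in>K. s (\<theta> z) (y \<theta> x))"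
      by (simp add: y_def scale_sum_right)
    finally show ?thesis .
  qed
  have KM: "K \<subseteq> multiplicative_characters G" using KX X by blast
  have "x = (\<Sum>\<theta>\<in>K. y \<theta> x)" for x
  proof -
    have "x = (\<Sum>\<theta>\<in>K. s (\<theta> 1) (y \<theta> x))" using expand[OF one, of x] act_one by simp
    also have "\<dots> = (\<Sum>\<theta>\<in>K. y \<theta> x)"
      using KM by (intro sum.cong refl) (auto simp: multiplicative_characters_def subset_iff)
    finally show ?thesis .
  qed
  moreover have "act z (y \<theta> x) = s (\<theta> z) (y \<theta> x)" if \<theta>: "\<theta> \<in> K" and z: "z \<in> G" for \<theta> z x
  proof -
    interpret lz: Vector_Spaces.linear s s "act z" by (rule lin[OF z])
    \<comment> \<open>With \<open>z\<close> fixed, \<open>act z (act w x)\<close> and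
      \<open>act (z * w) x\<close> are two expansions of one function of \<open>w\<close>; their
      coefficients must agree.\<close>
    have "(\<Sum>\<psi>\<in>K. s (\<psi> w) (act z (y \<psi> x) - s (\<psi> z) (y \<psi> x))) = 0" if w: "w \<in> G" for w
    proof -
      have "(\<Sum>\<psi>\<in>K. s (\<psi> w) (act z (y \<psi> x))) = act z (act w x)"
        by (simp add: expand[OF w] lz.sum lz.scale)
      also have "\<dots> = act (z * w) x" using act_mult z w by simp
      also have "\<dots> = (\<Sum>\<psi>\<in>K. s (\<psi> (z * w)) (y \<psi> x))" using expand mult z w by blast
      also have "\<dots> = (\<Sum>\<psi>\<in>K. s (\<psi> w) (s (\<psi> z) (y \<psi> x)))"
        using KM z w
        by (intro sum.cong refl) (auto simp: multiplicative_characters_def subset_iff mult_ac)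
      finally show ?thesis by (simp add: scale_right_diff_distrib sum_subtractf)
    qed
    from characters_independent[OF vector_space_axioms one mult finK KM this \<theta>]
    show ?thesis by simp
  qed
  ultimately show ?thesis using finK KX by blast
qed

section \<open>Integral cones\<close>

text \<open>Every sequence has a monotone subsequence, and a decreasing one in the naturals becomes
  constant.\<close>

lemma nat_seq_mono_subseq:
  fixes x :: "nat \<Rightarrow> nat"
  shows "\<exists>r :: nat \<Rightarrow> nat. strict_mono r \<and> mono (x \<circ> r)"
proof -
  obtain r :: "nat \<Rightarrow> nat" where r: "strict_mono r" "monoseq (\<lambda>n. x (r n))"
    using seq_monosub by blast
  show ?thesis
  proof (cases "mono (\<lambda>n. x (r n))")
    case True
    with r(1) show ?thesis by (intro exI[of _ r]) (simp add: comp_def)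
  next
    case False
    with r(2) have dec: "decseq (\<lambda>n. x (r n))"
      by (metis monoseq_iff)
    \<comment> \<open>From an index where the least value is attained, the decreasing sequence
      cannot move any more.\<close>
    obtain N where N: "\<And>n. x (r N) \<le> x (r n)"
      using ex_has_least_nat[of "\<lambda>_. True" 0 "\<lambda>n. x (r n)"] by auto
    have "x (r (N + n)) = x (r N)" for n
      using decseqD[OF dec, of N "N + n"] N[of "N + n"] by auto
    moreover have "strict_mono (\<lambda>n. r (N + n))"
      using r(1) by (auto simp: strict_mono_def)
    ultimately show ?thesis
      by (intro exI[of _ "\<lambda>n. r (N + n)"]) (auto simp: mono_def)
  qed
qed

text \<open>Dickson's lemma in sequence form: subsequences are extracted one coordinate at a time,
  and monotonicity already gained survives further extraction.\<close>

lemma dickson_subseq: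
  fixes x :: "nat \<Rightarrow> 'q \<Rightarrow> nat"
  assumes "finite Q"
  shows "\<exists>r :: nat \<Rightarrow> nat. strict_mono r \<and> (\<forall>q\<in>Q. mono (\<lambda>n. x (r n) q))"
  using assms
proof (induction Q)
  case empty
  show ?case by (intro exI[of _ id]) (simp add: strict_mono_def)
next
  case (insert q Q)
  then obtain r :: "nat \<Rightarrow> nat" where r: "strict_mono r" "\<And>p. p \<in> Q \<Longrightarrow> mono (\<lambda>n. x (r n) p)"
    by auto
  obtain r' :: "nat \<Rightarrow> nat" where r': "strict_mono r'" "mono ((\<lambda>n. x (r n) q) \<circ> r')"
    using nat_seq_mono_subseq by blast
  have "mono (\<lambda>n. x (r (r' n)) p)" if "p \<in> insert q Q" for p
  proof (cases "p = q")
    case True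
    with r'(2) show ?thesis by (simp add: comp_def)
  next
    case False
    with that have "mono (\<lambda>n. x (r n) p)" using r(2) by auto
    then show ?thesis
      using strict_mono_mono[OF r'(1)] by (auto simp: mono_def)
  qed
  moreover have "strict_mono (\<lambda>n. r (r' n))"
    using r(1) r'(1) by (auto simp: strict_mono_def)
  ultimately show ?case by (intro exI[of _ "\<lambda>n. r (r' n)"]) auto
qed

text \<open>Choose for each \<open>m\<close> a counterexample of minimal size.  By Dickson's lemma some counterexample
  for a large \<open>m\<close> dominates an earlier one coordinatewise; their difference is then a smaller
  counterexample.\<close>

lemma additive_cone_bound:
  fixes H :: "'a::minus set" and f h :: "'a \<Rightarrow> int"
  assumes H: "\<And>a b. a \<in> H \<Longrightarrow> b \<in> H \<Longrightarrow> a - b \<in> H"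
    and fin: "finite Q"
    and diff: "\<And>q a b. q \<in> insert f (insert h Q) \<Longrightarrow> q (a - b) = q a - q b"
    and f: "\<And>a. a \<in> H \<Longrightarrow> (\<And>q. q \<in> Q \<Longrightarrow> 0 \<le> q a) \<Longrightarrow> 0 \<le> f a"
    and fh: "\<And>a. a \<in> H \<Longrightarrow> (\<And>q. q \<in> Q \<Longrightarrow> 0 \<le> q a) \<Longrightarrow> 0 < h a \<Longrightarrow> 0 < f a"
  shows "\<exists>m::nat. \<forall>a\<in>H. (\<forall>q\<in>Q. 0 \<le> q a) \<longrightarrow> h a \<le> int m * f a"
proof (rule ccontr)
  \<comment> \<open>Putting \<open>f\<close> and \<open>h\<close> among the constraints makes a
    dominated difference keep both nonnegative and lets \<open>size\<close> count
    \<open>h\<close>.\<close>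
  define R where "R = insert f (insert h Q)"
  define C where "C = {a \<in> H. \<forall>q\<in>R. 0 \<le> q a}"
  define size where "size a = (\<Sum>q\<in>R. nat (q a))" for a
  define bad where "bad m a \<longleftrightarrow> a \<in> C \<and> int m * f a < h a" for m a
  assume "\<not> ?thesis"
  then have neg: "\<exists>a\<in>H. (\<forall>q\<in>Q. 0 \<le> q a) \<and> int m * f a < h a" for m
    by (meson linorder_not_less)
  \<comment> \<open>A counterexample has \<open>0 \<le> f a\<close>, hence
    \<open>0 \<le> h a\<close>, so it lies in \<open>C\<close> automatically.\<close>
  have "\<exists>a. bad m a" for m
  proof -
    from neg[of m] obtain a where a: "a \<in> H" "\<And>q. q \<in> Q \<Longrightarrow> 0 \<le> q a" "int m * f a < h a"
      by blast
    have "0 \<le> f a" using f a by blast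
    then have "0 \<le> int m * f a" by simp
    with a(3) have "0 \<le> h a" by linarith
    with a \<open>0 \<le> f a\<close> show ?thesis by (intro exI[of _ a]) (auto simp: bad_def C_def R_def)
  qed
  then have "\<exists>a. bad m a \<and> (\<forall>b. bad m b \<longrightarrow> size a \<le> size b)" for m
    using ex_has_least_nat[of "bad m"] by blast
  then obtain x where x: "\<And>m. bad m (x m)" "\<And>m b. bad m b \<Longrightarrow> size (x m) \<le> size b"
    by metis
  have finR: "finite R" using fin by (simp add: R_def)
  obtain r :: "nat \<Rightarrow> nat" where r: "strict_mono r" "\<And>q. q \<in> R \<Longrightarrow> mono (\<lambda>n. nat (q (x (r n))))"
    using dickson_subseq[OF finR, of "\<lambda>n q. nat (q (x n))"] by blast
  define i where "i = r 0"
  \<comment> \<open>A strictly increasing \<open>r\<close> satisfies \<open>n \<le> r n\<close>, so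
    this index makes \<open>j\<close> at least \<open>h (x i)\<close>.\<close>
  define j where "j = r (nat (h (x i)))"
  have iC: "x i \<in> C" and jC: "x j \<in> C" and jbad: "int j * f (x j) < h (x j)"
    using x(1) by (auto simp: bad_def)
  have hi: "0 < h (x i)"
  proof -
    have "0 \<le> int i * f (x i)" using iC by (auto simp: C_def R_def)
    then show ?thesis using x(1)[of i] by (auto simp: bad_def)
  qed
  have "nat (h (x i)) \<le> j" unfolding j_def by (rule seq_suble[OF r(1)])
  then have "h (x i) \<le> int j" by simp
  moreover have "1 \<le> f (x i)"
    using fh[of "x i"] iC hi by (auto simp: C_def R_def)
  \<comment> \<open>So \<open>x i\<close> satisfies the bound with constant \<open>j\<close>, and
    subtracting it from \<open>x j\<close> leaves a counterexample for \<open>j\<close>.\<close>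
  ultimately have le_i: "h (x i) \<le> int j * f (x i)"
    using mult_mono[of "h (x i)" "int j" 1 "f (x i)"] hi by simp
  have le: "q (x i) \<le> q (x j)" if "q \<in> R" for q
  proof -
    have "nat (q (x i)) \<le> nat (q (x j))"
      using r(2)[OF that] unfolding i_def j_def by (auto simp: mono_def)
    moreover have "0 \<le> q (x j)" using jC that by (simp add: C_def)
    ultimately show ?thesis by linarith
  qed
  have sub: "q (x j - x i) = q (x j) - q (x i)" if "q \<in> R" for q
    using diff that by (simp add: R_def)
  have "0 \<le> q (x j - x i)" if "q \<in> R" for q
    using le[OF that] sub[OF that] by simp
  then have dC: "x j - x i \<in> C"
    using iC jC H by (simp add: C_def)
  \<comment> \<open>No coordinate grows, and the coordinate \<open>h\<close> drops strictly since
    \<open>h (x i)\<close> is positive.\<close>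
  have "size (x j - x i) < size (x j)"
    unfolding size_def
  proof (rule sum_strict_mono_ex1[OF finR])
    show "\<forall>q\<in>R. nat (q (x j - x i)) \<le> nat (q (x j))"
    proof
      fix q assume q: "q \<in> R"
      then have "0 \<le> q (x i)" using iC by (simp add: C_def)
      then show "nat (q (x j - x i)) \<le> nat (q (x j))" using sub[OF q] by simp
    qed
    have "h \<in> R" by (simp add: R_def)
    then show "\<exists>q\<in>R. nat (q (x j - x i)) < nat (q (x j))"
      using sub[of h] le[of h] hi by (intro bexI[of _ h]) auto
  qed
  then have "\<not> bad j (x j - x i)" using x(2)[of j "x j - x i"] by auto
  then have "h (x j - x i) \<le> int j * f (x j - x i)" using dC by (auto simp: bad_def)
  then show False
    using sub[of f] sub[of h] le_i jbad by (auto simp: R_def right_diff_distrib)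
qed

section \<open>Weights along diagonal subgroups\<close>

lemma functionals_separate:
  assumes fd: "finite_dimensional_vector_space s B" and "\<And>\<phi>. functional s \<phi> \<Longrightarrow> \<phi> x = 0"
  shows "x = 0"
proof -
  interpret finite_dimensional_vector_space s B by (rule fd)
  have "x = (\<Sum>b\<in>B. s (representation B x b) b)"
    using sum_representation_eq[of B x B] independent_Basis span_Basis finite_Basis by simp
  also have "\<dots> = 0"
  proof (rule sum.neutral, intro ballI)
    fix b assume "b \<in> B"
    from assms(2)[OF functional_representation[OF fd this]] show "s (representation B x b) b = 0"
      by (simp only: scale_zero_left)
  qed
  finally show ?thesis .
qed

lemma powi_tendsto_zero:
  assumes "0 < (k::int)"
  shows "((\<lambda>t::complex. t powi k) \<longlongrightarrow> 0) (at 0)"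
proof -
  obtain n where n: "k = int (Suc n)"
    using assms by (metis gr0_implies_Suc zero_less_imp_eq_int)
  have "((\<lambda>t::complex. t ^ Suc n) \<longlongrightarrow> 0 ^ Suc n) (at 0)"
    by (intro tendsto_intros)
  then show ?thesis unfolding n power_int_of_nat by simp
qed

lemma eventually_nonzero: "\<forall>\<^sub>F t in at (0::complex). t \<noteq> 0"
  by (simp add: eventually_at_filter)

text \<open>The two rescaled curves differ by the factor \<open>t powi (k - j)\<close>, which tends
  to 0. Hence at most one exponent has a nonzero limit, as the definite description in
  \<open>weight\<close> requires.\<close>

lemma vector_tendsto_lower_weight:
  assumes fd: "finite_dimensional_vector_space s B" and "j < k"
    and lim: "vector_tendsto s (\<lambda>t. s (t powi (- k)) (x t)) u (at 0)"
      "vector_tendsto s (\<lambda>t. s (t powi (- j)) (x t)) u' (at 0)"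
  shows "u' = 0"
proof (rule functionals_separate[OF fd])
  fix \<phi> assume \<phi>: "functional s \<phi>"
  interpret \<phi>: Vector_Spaces.linear s "(*)" \<phi> by (rule \<phi>)
  have "((\<lambda>t. t powi (k - j) * \<phi> (s (t powi (- k)) (x t))) \<longlongrightarrow> 0 * \<phi> u) (at 0)"
    using \<open>j < k\<close> lim(1) \<phi>
    by (intro tendsto_mult powi_tendsto_zero) (auto simp: vector_tendsto_def)
  moreover have "\<forall>\<^sub>F t in at 0. t powi (k - j) * \<phi> (s (t powi (- k)) (x t))
      = \<phi> (s (t powi (- j)) (x t))"
    using eventually_nonzero
  proof eventually_elim
    case (elim t)
    then have "t powi (- j) = t powi (k - j) * t powi (- k)"
      by (simp flip: power_int_add)
    then show ?case by (simp add: \<phi>.scale)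
  qed
  ultimately have "((\<lambda>t. \<phi> (s (t powi (- j)) (x t))) \<longlongrightarrow> 0) (at 0)"
    by (simp add: tendsto_cong)
  moreover have "((\<lambda>t. \<phi> (s (t powi (- j)) (x t))) \<longlongrightarrow> \<phi> u') (at 0)"
    using lim(2) \<phi> by (simp add: vector_tendsto_def)
  ultimately show "\<phi> u' = 0" using tendsto_unique trivial_limit_at by blast
qed

lemma weight_eqI:
  assumes fd: "finite_dimensional_vector_space s B" and "u \<noteq> 0"
    and lim: "vector_tendsto s (\<lambda>t. s (t powi (- k)) (act (l t) v)) u (at 0)"
  shows "weight s act l v = k"
  unfolding weight_def
proof (rule the_equality)
  show "\<exists>u. u \<noteq> 0 \<and> vector_tendsto s (\<lambda>t. s (t powi (- k)) (act (l t) v)) u (at 0)"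
    using assms by blast
next
  fix j assume "\<exists>u. u \<noteq> 0 \<and> vector_tendsto s (\<lambda>t. s (t powi (- j)) (act (l t) v)) u (at 0)"
  then obtain u' where u': "u' \<noteq> 0" "vector_tendsto s (\<lambda>t. s (t powi (- j)) (act (l t) v)) u' (at 0)"
    by blast
  show "j = k"
    using vector_tendsto_lower_weight[OF fd _ lim u'(2)]
      vector_tendsto_lower_weight[OF fd _ u'(2) lim] u'(1) \<open>u \<noteq> 0\<close>
    by (metis linorder_neqE)
qed

text \<open>After rescaling, terms of exponent \<open>k\<close> are constant and those of higher
  exponent die out. Whether the limit is nonzero is left to the caller.\<close>

lemma vector_tendsto_lowest_part:
  fixes e :: "'k \<Rightarrow> int"
  assumes vs: "vector_space s" and "finite K"
    and x: "\<And>t. t \<noteq> 0 \<Longrightarrow> x t = (\<Sum>\<theta>\<in>K. s (t powi e \<theta>) (y \<theta>))"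
    and k: "\<And>\<theta>. \<theta> \<in> K \<Longrightarrow> y \<theta> \<noteq> 0 \<Longrightarrow> k \<le> e \<theta>"
  shows "vector_tendsto s (\<lambda>t. s (t powi (- k)) (x t)) (\<Sum>\<theta>\<in>{\<theta>\<in>K. e \<theta> = k}. y \<theta>) (at 0)"
  unfolding vector_tendsto_def
proof (intro allI impI)
  fix \<phi> assume \<phi>: "functional s \<phi>"
  interpret \<phi>: Vector_Spaces.linear s "(*)" \<phi> by (rule \<phi>)
  have summand: "((\<lambda>t. t powi (e \<theta> - k) * \<phi> (y \<theta>)) \<longlongrightarrow> (if e \<theta> = k then \<phi> (y \<theta>) else 0)) (at 0)"
    if \<theta>: "\<theta> \<in> K" for \<theta>
  \<comment> \<open>Exponents below \<open>k\<close> can occur only with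
    \<open>y \<theta> = 0\<close>, where the summand is identically zero.\<close>
  proof (cases "y \<theta> \<noteq> 0 \<and> e \<theta> \<noteq> k")
    case True
    then have "0 < e \<theta> - k" using k[OF \<theta>] by auto
    from tendsto_mult_left_zero[OF powi_tendsto_zero[OF this]] True show ?thesis by simp
  next
    case False
    then show ?thesis by (cases "e \<theta> = k") (auto simp: \<phi>.zero)
  qed
  have "((\<lambda>t. \<Sum>\<theta>\<in>K. t powi (e \<theta> - k) * \<phi> (y \<theta>)) \<longlongrightarrow> (\<Sum>\<theta>\<in>K. if e \<theta> = k then \<phi> (y \<theta>) else 0)) (at 0)"
    by (intro tendsto_sum summand)
  also have "(\<Sum>\<theta>\<in>K. if e \<theta> = k then \<phi> (y \<theta>) else 0) = \<phi> (\<Sum>\<theta>\<in>{\<theta>\<in>K. e \<theta> = k}. y \<theta>)"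
    unfolding \<phi>.sum using \<open>finite K\<close> by (simp add: sum.inter_filter)
  finally have "((\<lambda>t. \<Sum>\<theta>\<in>K. t powi (e \<theta> - k) * \<phi> (y \<theta>)) \<longlongrightarrow>
    \<phi> (\<Sum>\<theta>\<in>{\<theta>\<in>K. e \<theta> = k}. y \<theta>)) (at 0)" .
  moreover have "\<forall>\<^sub>F t in at 0. (\<Sum>\<theta>\<in>K. t powi (e \<theta> - k) * \<phi> (y \<theta>)) = \<phi> (s (t powi (- k)) (x t))"
    using eventually_nonzero
  proof eventually_elim
    case (elim t)
    then have "t powi (e \<theta> - k) = t powi (- k) * t powi e \<theta>" for \<theta>
      by (simp flip: power_int_add)
    then show ?case
      by (simp add: x[OF elim] \<phi>.scale \<phi>.sum sum_distrib_left mult.assoc)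
  qed
  ultimately show "((\<lambda>t. \<phi> (s (t powi (- k)) (x t))) \<longlongrightarrow> \<phi> (\<Sum>\<theta>\<in>{\<theta>\<in>K. e \<theta> = k}. y \<theta>)) (at 0)"
    by (simp add: tendsto_cong)
qed

section \<open>The diagonal torus, its monomials and its cocharacters\<close>

definition diagonal_matrix :: "complex^'n \<Rightarrow> complex^'n^'n" where
  "diagonal_matrix z = (\<chi> i j. if i = j then z $ i else 0)"

definition unit_torus :: "(complex^'n) set" where
  "unit_torus = {z. (\<Prod>i\<in>UNIV. z $ i) = 1}"

text \<open>Exponents in \<open>nat\<close> suffice, since the product of the coordinates is \<open>1\<close> on the torus.\<close>

definition torus_monomial :: "('n \<Rightarrow> nat) \<Rightarrow> complex^'n \<Rightarrow> complex" where
  "torus_monomial \<kappa> z = (if z \<in> unit_torus then \<Prod>i\<in>UNIV. z $ i ^ \<kappa> i else 0)"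

definition cocharacter :: "('n \<Rightarrow> int) \<Rightarrow> complex \<Rightarrow> complex^'n" where
  "cocharacter a t = (\<chi> i. t powi a i)"

text \<open>The duality between characters and cocharacters. Adding a constant to all entries of
  \<kappa> changes neither the monomial nor, if \<open>a\<close> has sum 0, the pairing.\<close>

definition pairing :: "('n::finite \<Rightarrow> nat) \<Rightarrow> ('n \<Rightarrow> int) \<Rightarrow> int" where
  "pairing \<kappa> a = (\<Sum>i\<in>UNIV. int (\<kappa> i) * a i)"

text \<open>For finite nonempty \<open>S\<close>, the lower support function of the convex hull of
  \<open>S\<close>.\<close>

definition min_pairing :: "('n::finite \<Rightarrow> nat) set \<Rightarrow> ('n \<Rightarrow> int) \<Rightarrow> int" where
  "min_pairing S a = Min ((\<lambda>\<kappa>. pairing \<kappa> a) ` S)"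

lemma diagonal_matrix_one: "diagonal_matrix 1 = mat 1"
  by (simp add: diagonal_matrix_def mat_def vec_eq_iff)

lemma diagonal_matrix_mult: "diagonal_matrix (z * w) = diagonal_matrix z ** diagonal_matrix w"
proof -
  have "(\<Sum>k\<in>UNIV. (if i = k then z $ i else 0) * (if k = j then w $ k else 0))
      = (\<Sum>k\<in>UNIV. if k = i then if i = j then z $ i * w $ i else 0 else 0)" for i j
    by (intro sum.cong) auto
  then show ?thesis
    by (simp add: diagonal_matrix_def matrix_matrix_mult_def vec_eq_iff)
qed

lemma det_diagonal_matrix: "det (diagonal_matrix z) = (\<Prod>i\<in>UNIV. z $ i)"
  by (subst det_diagonal) (auto simp: diagonal_matrix_def)

lemma diagonal_matrix_in_SL: "diagonal_matrix z \<in> SL \<longleftrightarrow> z \<in> unit_torus"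
  by (simp add: SL_def unit_torus_def det_diagonal_matrix)

lemma one_in_unit_torus: "1 \<in> unit_torus"
  by (simp add: unit_torus_def)

lemma mult_in_unit_torus: "z \<in> unit_torus \<Longrightarrow> w \<in> unit_torus \<Longrightarrow> z * w \<in> unit_torus"
  by (simp add: unit_torus_def prod.distrib)

lemma torus_monomial_mult:
  "torus_monomial \<kappa> z * torus_monomial \<mu> z = torus_monomial (\<lambda>i. \<kappa> i + \<mu> i) z"
  by (simp add: torus_monomial_def power_add prod.distrib)

lemma torus_monomial_character: "torus_monomial \<kappa> \<in> multiplicative_characters unit_torus"
  unfolding multiplicative_characters_def torus_monomial_def
  by (simp add: one_in_unit_torus mult_in_unit_torus power_mult_distrib prod.distrib)

lemma prod_powi: "(t::complex) \<noteq> 0 \<Longrightarrow> (\<Prod>i\<in>I. t powi a i) = t powi (\<Sum>i\<in>I. a i)"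
  by (induction I rule: infinite_finite_induct) (simp_all add: power_int_add)

lemma cocharacter_in_unit_torus:
  assumes "t \<noteq> 0" "sum a UNIV = 0"
  shows "cocharacter a t \<in> unit_torus"
  using assms by (simp add: unit_torus_def cocharacter_def prod_powi)

lemma torus_monomial_cocharacter:
  assumes "t \<noteq> 0" "sum a UNIV = 0"
  shows "torus_monomial \<kappa> (cocharacter a t) = t powi pairing \<kappa> a"
proof -
  have "(t powi a i) ^ \<kappa> i = t powi (int (\<kappa> i) * a i)" for i
    using power_int_mult[of t "a i" "int (\<kappa> i)"] by (simp add: power_int_of_nat mult.commute)
  then show ?thesis
    using assms cocharacter_in_unit_torus[OF assms]
    by (simp add: torus_monomial_def cocharacter_def pairing_def prod_powi)
qed

text \<open>On the torus an off-diagonal entry is 0 and a diagonal entry is a monomial; products of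
  monomials are monomials.\<close>

lemma regular_on_SL_diagonal:
  assumes "regular_on SL f"
  shows "character_combination (range torus_monomial) unit_torus (\<lambda>z. f (diagonal_matrix z))"
proof -
  obtain p where p: "p \<in> generated_algebra matrix_coords" "\<And>A. A \<in> SL \<Longrightarrow> f A = p A"
    using assms by (auto simp: restricts_from_def)
  have one: "torus_monomial (\<lambda>_. 0) \<in> range torus_monomial"
    "\<And>z. z \<in> unit_torus \<Longrightarrow> torus_monomial (\<lambda>_. 0) z = 1"
    by (auto simp: torus_monomial_def)
  have coord: "character_combination (range torus_monomial) unit_torus (\<lambda>z. q (diagonal_matrix z))"
    if "q \<in> matrix_coords" for q
  proof -
    obtain i j where q: "q = (\<lambda>A. A $ i $ j)" using \<open>q \<in> matrix_coords\<close> by (auto simp: matrix_coords_def)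
    show ?thesis
    proof (cases "i = j")
      case True
      have mon: "torus_monomial (\<lambda>k. if k = i then 1 else 0) z = z $ i" if "z \<in> unit_torus" for z
      proof -
        have "(\<Prod>k\<in>UNIV. z $ k ^ (if k = i then 1 else 0)) = (\<Prod>k\<in>UNIV. if k = i then z $ k else 1)"
          by (intro prod.cong) auto
        then show ?thesis using that by (simp add: torus_monomial_def)
      qed
      show ?thesis unfolding q
        by (rule character_combination_scaled[of "torus_monomial (\<lambda>k. if k = i then 1 else 0)" _ _ _ 1])
           (use True mon in \<open>auto simp: diagonal_matrix_def\<close>)
    next
      case False
      then show ?thesis using character_combination_zero by (simp add: q diagonal_matrix_def)
    qed
  qed
  have "character_combination (range torus_monomial) unit_torus (\<lambda>z. p (diagonal_matrix z))"
    by (rule generated_algebra_character_combination[OF p(1) coord one])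
       (auto simp: torus_monomial_mult)
  then show ?thesis
    by (rule character_combination_cong) (simp add: p(2) diagonal_matrix_in_SL)
qed

lemma SL_mult: "g \<in> SL \<Longrightarrow> h \<in> SL \<Longrightarrow> g ** h \<in> SL"
  by (simp add: SL_def det_mul)

lemma SL_inverse:
  assumes "g \<in> SL"
  obtains h where "h \<in> SL" "g ** h = mat 1" "h ** g = mat 1"
proof -
  have "invertible g" using assms by (simp add: invertible_det_nz SL_def)
  then obtain h where h: "g ** h = mat 1" "h ** g = mat 1" by (auto simp: invertible_def)
  then have "det g * det h = 1" by (metis det_I det_mul)
  with assms h show ?thesis by (intro that[of h]) (auto simp: SL_def)
qed

text \<open>Here \<open>h\<close> stands for the inverse of \<open>g\<close>; it is a separate
  argument because the relevant support is that of \<open>act h v\<close>.\<close>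

definition diagonal_subgroup ::
  "complex^'n^'n \<Rightarrow> ('n \<Rightarrow> int) \<Rightarrow> complex^'n^'n \<Rightarrow> complex \<Rightarrow> complex^'n^'n" where
  "diagonal_subgroup g a h t = g ** diagonal_matrix (cocharacter a t) ** h"

text \<open>Moving \<open>v\<close> by \<open>h\<close> reduces to the diagonal torus, where the
  component of character \<theta> is multiplied by a power of \<open>t\<close>; the lowest power
  with a nonzero component is the weight. \<open>S h\<close> is the support of
  \<open>act h v\<close>, and \<open>K\<close> is fixed before \<open>h\<close>, which leaves only
  finitely many supports.\<close>

lemma weight_eq_min_pairing:
  fixes act :: "complex^'n^'n \<Rightarrow> 'v::ab_group_add \<Rightarrow> 'v"
  assumes rep: "rational_representation s act" and "v \<noteq> 0"
  obtains K S where "finite K" "\<And>h. h \<in> SL \<Longrightarrow> S h \<subseteq> K" "\<And>h. h \<in> SL \<Longrightarrow> S h \<noteq> {}"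
    "\<And>g h a l. g \<in> SL \<Longrightarrow> h \<in> SL \<Longrightarrow> h ** g = mat 1 \<Longrightarrow> sum a UNIV = 0 \<Longrightarrow>
      (\<And>t. t \<noteq> 0 \<Longrightarrow> l t = diagonal_subgroup g a h t) \<Longrightarrow>
      weight s act l v = min_pairing (S h) a"
proof -
  obtain B where fd: "finite_dimensional_vector_space s B"
    using rep by (auto simp: rational_representation_def)
  interpret finite_dimensional_vector_space s B by (rule fd)
  have lin: "Vector_Spaces.linear s s (act g)" if "g \<in> SL" for g
    using rep that by (simp add: rational_representation_def)
  have act_one: "act (mat 1) x = x" for x
    using rep by (simp add: rational_representation_def)
  have act_mult: "act (g ** h) x = act g (act h x)" if "g \<in> SL" "h \<in> SL" for g h x
    using rep that by (simp add: rational_representation_def)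
  have reg: "regular_on SL (\<lambda>g. \<phi> (act g x))" if "functional s \<phi>" for \<phi> x
    using rep that by (simp add: rational_representation_def)
  have "\<exists>K c. finite K \<and> K \<subseteq> range torus_monomial \<and> (\<forall>x. x = (\<Sum>\<theta>\<in>K. c \<theta> x) \<and>
    (\<forall>\<theta>\<in>K. \<forall>z\<in>unit_torus. act (diagonal_matrix z) (c \<theta> x) = s (\<theta> z) (c \<theta> x)))"
  proof (rule isotypic_decomposition[OF fd one_in_unit_torus mult_in_unit_torus])
    show "range torus_monomial \<subseteq> multiplicative_characters (unit_torus :: (complex^'n) set)"
      using torus_monomial_character by blast
    show "act (diagonal_matrix 1) x = x" for x by (simp only: diagonal_matrix_one act_one)
    show "Vector_Spaces.linear s s (act (diagonal_matrix z))" if "z \<in> unit_torus" for z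
      using that by (intro lin) (simp only: diagonal_matrix_in_SL)
    show "act (diagonal_matrix (z * w)) x = act (diagonal_matrix z) (act (diagonal_matrix w) x)"
      if "z \<in> unit_torus" "w \<in> unit_torus" for z w x
      using that by (simp only: diagonal_matrix_mult act_mult diagonal_matrix_in_SL)
    show "character_combination (range torus_monomial) unit_torus (\<lambda>z. \<phi> (act (diagonal_matrix z) x))"
      if "functional s \<phi>" for \<phi> x
      by (rule regular_on_SL_diagonal[OF reg[OF that]])
  qed
  then obtain K :: "(complex^'n \<Rightarrow> complex) set" and c
    where K: "finite K" "K \<subseteq> range torus_monomial" and c: "\<And>x. x = (\<Sum>\<theta>\<in>K. c \<theta> x)"
      "\<And>x \<theta> z. \<theta> \<in> K \<Longrightarrow> z \<in> unit_torus \<Longrightarrow> act (diagonal_matrix z) (c \<theta> x) = s (\<theta> z) (c \<theta> x)"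
    by blast
  \<comment> \<open>Several exponent vectors can give the same function on the torus, so one is
    chosen for each character.\<close>
  obtain e where e: "\<And>\<theta>. \<theta> \<in> K \<Longrightarrow> torus_monomial (e \<theta>) = \<theta>"
    using K(2) f_inv_into_f[of _ torus_monomial UNIV] by blast
  define S where "S h = e ` {\<theta>\<in>K. c \<theta> (act h v) \<noteq> 0}" for h
  have inverse: "act h (act g x) = x" if "h ** g = mat 1" "g \<in> SL" "h \<in> SL" for g h x
    using that act_mult[of h g x] act_one by simp
  have zero: "act g 0 = 0" if "g \<in> SL" for g
  proof -
    interpret lg: Vector_Spaces.linear s s "act g" by (rule lin[OF that])
    show ?thesis by (rule lg.zero)
  qed
  have nonempty: "S h \<noteq> {}" if h: "h \<in> SL" for h
  proof
    assume "S h = {}"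
    then have "(\<Sum>\<theta>\<in>K. c \<theta> (act h v)) = 0"
      by (intro sum.neutral) (auto simp: S_def)
    with c(1)[of "act h v"] have "act h v = 0" by (rule trans)
    moreover obtain g where "g \<in> SL" "g ** h = mat 1" using SL_inverse[OF h] by blast
    ultimately show False using inverse[of g h v] zero h \<open>v \<noteq> 0\<close> by simp
  qed
  have weight: "weight s act l v = min_pairing (S h) a"
    if g: "g \<in> SL" and h: "h \<in> SL" and hg: "h ** g = mat 1" and a: "sum a UNIV = 0"
      and l: "\<And>t. t \<noteq> 0 \<Longrightarrow> l t = diagonal_subgroup g a h t" for g h a l
  proof -
    interpret lg: Vector_Spaces.linear s s "act g" by (rule lin[OF g])
    define k where "k = Min ((\<lambda>\<kappa>. pairing \<kappa> a) ` S h)"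
    define x where "x = act h v"
    define K' where "K' = {\<theta>\<in>K. pairing (e \<theta>) a = k}"
    have finS: "finite (S h)" using K(1) by (simp add: S_def)
    have "act (l t) v = (\<Sum>\<theta>\<in>K. s (t powi pairing (e \<theta>) a) (act g (c \<theta> x)))" if t: "t \<noteq> 0" for t
    proof -
      have z: "cocharacter a t \<in> unit_torus" using cocharacter_in_unit_torus[OF t a] .
      interpret ld: Vector_Spaces.linear s s "act (diagonal_matrix (cocharacter a t))"
        using lin z by (simp add: diagonal_matrix_in_SL)
      have dSL: "diagonal_matrix (cocharacter a t) \<in> SL" using z by (simp add: diagonal_matrix_in_SL)
      have "g ** diagonal_matrix (cocharacter a t) \<in> SL"
        using g dSL by (simp add: SL_def det_mul)
      then have "act (l t) v = act g (act (diagonal_matrix (cocharacter a t)) x)"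
        using l[OF t] g h dSL by (simp add: act_mult x_def diagonal_subgroup_def)
      also have "act (diagonal_matrix (cocharacter a t)) x
          = (\<Sum>\<theta>\<in>K. act (diagonal_matrix (cocharacter a t)) (c \<theta> x))"
        by (subst c(1)[of x]) (simp add: ld.sum)
      also have "\<dots> = (\<Sum>\<theta>\<in>K. s (t powi pairing (e \<theta>) a) (c \<theta> x))"
      proof (rule sum.cong[OF refl])
        fix \<theta> assume "\<theta> \<in> K"
        then show "act (diagonal_matrix (cocharacter a t)) (c \<theta> x) = s (t powi pairing (e \<theta>) a) (c \<theta> x)"
          using c(2)[OF _ z] torus_monomial_cocharacter[OF t a, of "e \<theta>"] by (simp add: e)
      qed
      finally show ?thesis by (simp add: lg.sum lg.scale)
    qed
    moreover have "k \<le> pairing (e \<theta>) a" if "\<theta> \<in> K" "act g (c \<theta> x) \<noteq> 0" for \<theta>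
    proof -
      have "e \<theta> \<in> S h" using that zero[OF g] by (auto simp: S_def x_def)
      then show ?thesis using finS by (simp add: k_def)
    qed
    ultimately have lim: "vector_tendsto s (\<lambda>t. s (t powi (- k)) (act (l t) v))
        (\<Sum>\<theta>\<in>K'. act g (c \<theta> x)) (at 0)"
      unfolding K'_def by (intro vector_tendsto_lowest_part[OF vector_space_axioms K(1)])
    \<comment> \<open>The lowest part cannot cancel: \<open>act g\<close> is injective, and
      components for distinct characters are independent.\<close>
    have "(\<Sum>\<theta>\<in>K'. act g (c \<theta> x)) \<noteq> 0"
    proof
      assume "(\<Sum>\<theta>\<in>K'. act g (c \<theta> x)) = 0"
      then have "act g (\<Sum>\<theta>\<in>K'. c \<theta> x) = 0" by (simp add: lg.sum)
      then have 0: "(\<Sum>\<theta>\<in>K'. c \<theta> x) = 0"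
        using inverse[OF hg g h, of "\<Sum>\<theta>\<in>K'. c \<theta> x"] zero[OF h] by simp
      have fin: "finite K'" using K(1) by (simp add: K'_def)
      have chars: "K' \<subseteq> multiplicative_characters unit_torus"
        using K(2) torus_monomial_character by (auto simp: K'_def)
      \<comment> \<open>Acting by \<open>z\<close> on the vanishing sum multiplies each summand by
        its character value, which gives a relation among characters.\<close>
      have indep: "(\<Sum>\<theta>\<in>K'. s (\<theta> z) (c \<theta> x)) = 0" if z: "z \<in> unit_torus" for z
      proof -
        interpret ld: Vector_Spaces.linear s s "act (diagonal_matrix z)"
          using lin z by (simp add: diagonal_matrix_in_SL)
        have "(\<Sum>\<theta>\<in>K'. s (\<theta> z) (c \<theta> x)) = (\<Sum>\<theta>\<in>K'. act (diagonal_matrix z) (c \<theta> x))"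
          using c(2) z by (intro sum.cong) (auto simp: K'_def)
        also have "\<dots> = 0" using 0 by (simp add: ld.zero flip: ld.sum)
        finally show ?thesis .
      qed
      \<comment> \<open>The minimum is attained at a character whose component of \<open>x\<close>
        is nonzero, contradicting independence.\<close>
      have "k \<in> (\<lambda>\<kappa>. pairing \<kappa> a) ` S h"
        unfolding k_def using finS nonempty[OF h] by (intro Min_in) auto
      then obtain \<theta> where \<theta>: "\<theta> \<in> K'" "c \<theta> x \<noteq> 0"
        by (auto simp: S_def K'_def x_def)
      from characters_independent[OF vector_space_axioms one_in_unit_torus mult_in_unit_torus fin
          chars indep \<theta>(1)] \<theta>(2)
      show False by simp
    qed
    from weight_eqI[where act = act and l = l and v = v and k = k, OF fd this lim]
    show ?thesis by (simp add: k_def min_pairing_def)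
  qed
  show ?thesis
  proof (rule that[of "e ` K" S])
    show "finite (e ` K)" using K(1) by simp
    show "S h \<subseteq> e ` K" for h by (auto simp: S_def)
  qed (fact nonempty weight)+
qed

section \<open>Diagonalization of one-parameter subgroups\<close>

text \<open>The value at 0 is forced by \<open>multiplicative_characters\<close>; it matters only
  for \<open>k = 0\<close>, since \<open>0 powi 0\<close> is 1.\<close>

definition laurent_monomial :: "int \<Rightarrow> complex \<Rightarrow> complex" where
  "laurent_monomial k t = (if t = 0 then 0 else t powi k)"

lemma laurent_monomial_mult:
  "laurent_monomial j t * laurent_monomial k t = laurent_monomial (j + k) t"
  by (simp add: laurent_monomial_def power_int_add)

lemma laurent_monomial_character: "laurent_monomial k \<in> multiplicative_characters (-{0})"
  by (auto simp: multiplicative_characters_def laurent_monomial_def power_int_mult_distrib)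

lemma regular_on_punctured_plane:
  assumes "restricts_from {\<lambda>t. t, inverse} (-{0}) f"
  shows "character_combination (range laurent_monomial) (-{0}) f"
proof -
  obtain p where p: "p \<in> generated_algebra {\<lambda>t. t, inverse}" "\<And>t. t \<noteq> 0 \<Longrightarrow> f t = p t"
    using assms by (auto simp: restricts_from_def)
  have one: "laurent_monomial 0 \<in> range laurent_monomial"
    "\<And>t. t \<in> -{0} \<Longrightarrow> laurent_monomial 0 t = 1"
    by (auto simp: laurent_monomial_def)
  have coord: "character_combination (range laurent_monomial) (-{0}) (\<lambda>t. q t)"
    if q: "q \<in> {\<lambda>t. t, inverse}" for q
  proof -
    from q consider "q = (\<lambda>t. t)" | "q = inverse" by blast
    then show ?thesis
    proof cases
      case 1
      show ?thesis unfolding 1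
        by (rule character_combination_scaled[of "laurent_monomial 1" _ _ _ 1])
           (auto simp: laurent_monomial_def)
    next
      case 2
      show ?thesis unfolding 2
        by (rule character_combination_scaled[of "laurent_monomial (-1)" _ _ _ 1])
           (auto simp: laurent_monomial_def power_int_minus)
    qed
  qed
  have "character_combination (range laurent_monomial) (-{0}) (\<lambda>t. p t)"
    by (rule generated_algebra_character_combination[where \<tau> = "\<lambda>t. t", OF p(1) coord one])
       (auto simp: laurent_monomial_mult)
  then show ?thesis
    by (rule character_combination_cong) (simp add: p(2))
qed

lemma functional_vec_expansion:
  fixes y :: "complex^'n"
  assumes "functional (*s) \<phi>"
  shows "\<phi> y = (\<Sum>i\<in>UNIV. y $ i * \<phi> (axis i 1))"
proof -
  interpret \<phi>: Vector_Spaces.linear "(*s)" "(*)" \<phi> by (rule assms)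
  have "\<phi> y = \<phi> (\<Sum>i\<in>UNIV. y $ i *s axis i 1)" by (simp add: basis_expansion)
  also have "\<dots> = (\<Sum>i\<in>UNIV. y $ i * \<phi> (axis i 1))" by (simp only: \<phi>.sum \<phi>.scale)
  finally show ?thesis .
qed

text \<open>The isotypic decomposition for the punctured plane acting through \<open>l\<close>: the
  matrix entries are Laurent polynomials, so every vector is a sum of eigenvectors with characters
  \<open>t powi k\<close>.\<close>

lemma span_eigenvectors:
  fixes l :: "complex \<Rightarrow> complex^'n^'n"
  assumes l: "one_parameter_subgroup l"
  shows "vec.span {b. \<exists>k. \<forall>t. t \<noteq> 0 \<longrightarrow> l t *v b = (t powi k) *s b} = UNIV"
proof -
  have SL: "l t \<in> SL" if "t \<noteq> 0" for t
    using l that by (simp add: one_parameter_subgroup_def)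
  have mult: "l (s * t) = l s ** l t" if "s \<noteq> 0" "t \<noteq> 0" for s t
    using l that by (simp add: one_parameter_subgroup_def)
  have entry: "character_combination (range laurent_monomial) (-{0}) (\<lambda>t. l t $ i $ j)" for i j
    using l regular_on_punctured_plane by (simp add: one_parameter_subgroup_def)
  \<comment> \<open>An invertible idempotent is the identity.\<close>
  have l1: "l 1 = mat 1"
  proof -
    obtain h where h: "h ** l 1 = mat 1" using SL_inverse[OF SL[of 1]] by auto
    have "h ** (l 1 ** l 1) = h ** l 1" using mult[of 1 1] by simp
    then show ?thesis by (simp add: matrix_mul_assoc h)
  qed
  have "\<exists>K c. finite K \<and> K \<subseteq> range laurent_monomial \<and> (\<forall>x. x = (\<Sum>\<theta>\<in>K. c \<theta> x) \<and>
    (\<forall>\<theta>\<in>K. \<forall>t\<in>-{0}. l t *v c \<theta> x = \<theta> t *s c \<theta> x))"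
  proof (rule isotypic_decomposition[OF vec.finite_dimensional_vector_space_axioms])
    show "range laurent_monomial \<subseteq> multiplicative_characters (-{0})"
      using laurent_monomial_character by blast
    fix \<phi> :: "complex^'n \<Rightarrow> complex" and x assume \<phi>: "functional (*s) \<phi>"
    have const: "character_combination (range laurent_monomial) (-{0}) (\<lambda>_. r)" for r
      by (rule character_combination_scaled[of "laurent_monomial 0" _ _ _ r])
         (auto simp: laurent_monomial_def)
    have "character_combination (range laurent_monomial) (-{0})
        (\<lambda>t. \<Sum>i\<in>UNIV. \<Sum>j\<in>UNIV. l t $ i $ j * (x $ j * \<phi> (axis i 1)))"
      by (intro character_combination_sum character_combination_mult[OF _ entry const])
         (auto simp: laurent_monomial_mult)
    moreover have "\<phi> (l t *v x) = (\<Sum>i\<in>UNIV. \<Sum>j\<in>UNIV. l t $ i $ j * (x $ j * \<phi> (axis i 1)))" for t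
      by (subst functional_vec_expansion[OF \<phi>])
         (simp add: matrix_vector_mult_def sum_distrib_right mult.assoc)
    ultimately show "character_combination (range laurent_monomial) (- {0}) (\<lambda>t. \<phi> (l t *v x))"
      by simp
  qed (simp_all add: l1 mult matrix_vector_mul_assoc)
  then obtain K c where K: "K \<subseteq> range laurent_monomial"
    and c: "\<And>x. x = (\<Sum>\<theta>\<in>K. c \<theta> x)"
      "\<And>x \<theta> t. \<theta> \<in> K \<Longrightarrow> t \<noteq> 0 \<Longrightarrow> l t *v c \<theta> x = \<theta> t *s c \<theta> x"
    by blast
  have "c \<theta> x \<in> {b. \<exists>k. \<forall>t. t \<noteq> 0 \<longrightarrow> l t *v b = (t powi k) *s b}" if \<theta>: "\<theta> \<in> K" for \<theta> x
  proof -
    obtain k where "\<theta> = laurent_monomial k" using K \<theta> by blast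
    then show ?thesis using c(2)[OF \<theta>] by (auto simp: laurent_monomial_def)
  qed
  then have "(\<Sum>\<theta>\<in>K. c \<theta> x) \<in> vec.span {b. \<exists>k. \<forall>t. t \<noteq> 0 \<longrightarrow> l t *v b = (t powi k) *s b}" for x
    by (intro vec.span_sum vec.span_base)
  then have "x \<in> vec.span {b. \<exists>k. \<forall>t. t \<noteq> 0 \<longrightarrow> l t *v b = (t powi k) *s b}" for x
    by (subst c(1)[of x])
  then show ?thesis by blast
qed

text \<open>A basis of common eigenvectors, taken as columns, diagonalizes \<open>l\<close>;
  rescaling one column brings the determinant to 1.\<close>

lemma one_parameter_subgroup_diagonalizable:
  fixes l :: "complex \<Rightarrow> complex^'n^'n"
  assumes l: "one_parameter_subgroup l"
  obtains g h a where "g \<in> SL" "h \<in> SL" "h ** g = mat 1" "sum a UNIV = 0"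
    "\<And>t. t \<noteq> 0 \<Longrightarrow> l t = diagonal_subgroup g a h t"
proof -
  define E where "E = {b. \<exists>k. \<forall>t. t \<noteq> 0 \<longrightarrow> l t *v b = (t powi k) *s b}"
  obtain B where B: "B \<subseteq> E" "vec.independent B" "E \<subseteq> vec.span B"
    using vec.maximal_independent_subset by blast
  have spanB: "vec.span B = UNIV"
    using span_eigenvectors[OF l] B(3) vec.span_minimal[OF B(3) vec.subspace_span]
    by (auto simp: E_def)
  have cardB: "card B = CARD('n)"
    using vec.basis_card_eq_dim[of B UNIV] B(2) spanB by (simp add: card_cart_basis)
  moreover have "finite B" using B(2) by (rule vec.finiteI_independent)
  ultimately obtain f :: "'n \<Rightarrow> complex^'n" where f: "bij_betw f UNIV B"
    using finite_same_card_bij[of "UNIV :: 'n set" B] by auto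
  have "\<forall>i. \<exists>k. \<forall>t. t \<noteq> 0 \<longrightarrow> l t *v f i = (t powi k) *s f i"
    using f B(1) by (auto simp: bij_betw_def E_def)
  then obtain a where a: "\<And>i t. t \<noteq> 0 \<Longrightarrow> l t *v f i = (t powi a i) *s f i"
    by metis
  define A where "A = (\<chi> i j. f j $ i)"
  have "columns A = B"
    using f by (auto simp: columns_def column_def A_def bij_betw_def vec_lambda_eta)
  then have "\<exists>A'. A ** A' = mat 1"
    using spanB by (simp add: matrix_right_invertible_span_columns)
  then have "invertible A" by (auto simp: invertible_def matrix_left_right_inverse)
  then have detA: "det A \<noteq> 0" by (simp add: invertible_det_nz)
  \<comment> \<open>Any index will do: \<open>z\<close> scales that one column by the inverse
    determinant.\<close>
  define i0 :: 'n where "i0 = undefined"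
  define z :: "complex^'n" where "z = (\<chi> i. if i = i0 then inverse (det A) else 1)"
  define g where "g = A ** diagonal_matrix z"
  have "(\<Prod>i\<in>UNIV. z $ i) = inverse (det A)" by (simp add: z_def)
  then have gSL: "g \<in> SL" using detA by (simp add: g_def SL_def det_mul det_diagonal_matrix)
  then obtain h where h: "h \<in> SL" "g ** h = mat 1" "h ** g = mat 1" by (rule SL_inverse)
  have AA: "l t ** A = A ** diagonal_matrix (cocharacter a t)" if t: "t \<noteq> 0" for t
  proof -
    have "(l t ** A) $ i $ j = (A ** diagonal_matrix (cocharacter a t)) $ i $ j" for i j
    proof -
      have "(l t ** A) $ i $ j = (l t *v f j) $ i"
        by (simp add: matrix_matrix_mult_def matrix_vector_mult_def A_def)
      also have "\<dots> = f j $ i * t powi a j" by (simp add: a[OF t])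
      also have "\<dots> = (\<Sum>k\<in>UNIV. if k = j then f k $ i * t powi a k else 0)" by simp
      also have "\<dots> = (\<Sum>k\<in>UNIV. f k $ i * (if k = j then t powi a k else 0))"
        by (intro sum.cong) auto
      also have "\<dots> = (A ** diagonal_matrix (cocharacter a t)) $ i $ j"
        by (simp only: matrix_matrix_mult_def diagonal_matrix_def A_def cocharacter_def vec_lambda_beta)
      finally show ?thesis .
    qed
    then show ?thesis by (simp add: vec_eq_iff)
  qed
  have lt: "l t = g ** diagonal_matrix (cocharacter a t) ** h" if t: "t \<noteq> 0" for t
  proof -
    have "l t ** g = A ** (diagonal_matrix (cocharacter a t) ** diagonal_matrix z)"
      by (simp add: g_def matrix_mul_assoc AA[OF t])
    \<comment> \<open>Diagonal matrices commute, so the rescaling preserves the diagonal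
      form.\<close>
    also have "\<dots> = g ** diagonal_matrix (cocharacter a t)"
      by (simp add: g_def flip: diagonal_matrix_mult matrix_mul_assoc) (simp add: mult.commute)
    finally have "l t ** (g ** h) = g ** diagonal_matrix (cocharacter a t) ** h"
      by (simp add: matrix_mul_assoc)
    then show ?thesis by (simp add: h(2))
  qed
  \<comment> \<open>The determinant of \<open>l t\<close> is \<open>t powi (sum a UNIV)\<close>; at
    2, which is not a root of unity, it equals 1 only for exponent 0.\<close>
  have "sum a UNIV = 0"
  proof -
    have "det (l 2) = 1" using l by (simp add: one_parameter_subgroup_def SL_def)
    moreover have "det g * det h = 1" using gSL h(1) by (simp add: SL_def)
    ultimately have "(2::complex) powi (sum a UNIV) = 1"
      using gSL h(1)
      by (simp add: lt det_mul det_diagonal_matrix cocharacter_def prod_powi SL_def)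
    then have "norm ((2::complex) powi (sum a UNIV)) = 1" by simp
    then have "(2::real) powi (sum a UNIV) = 1" by (simp add: norm_power_int)
    then show ?thesis
      using power_int_strict_increasing[of "sum a UNIV" 0 "2::real"]
        power_int_strict_increasing[of 0 "sum a UNIV" "2::real"]
      by (cases "sum a UNIV" "0::int" rule: linorder_cases) simp_all
  qed
  then show ?thesis
    by (rule that[OF gSL h(1) h(3)]) (simp add: lt diagonal_subgroup_def)
qed

section \<open>Algebraicity of conjugated diagonal subgroups\<close>

lemma generated_algebra_power:
  "f \<in> generated_algebra F \<Longrightarrow> (\<lambda>x. f x ^ n) \<in> generated_algebra F"
  by (induction n) (auto intro: generated_algebra.const generated_algebra.mult)

lemma generated_algebra_sum:
  assumes "\<And>i. i \<in> I \<Longrightarrow> f i \<in> generated_algebra F"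
  shows "(\<lambda>x. \<Sum>i\<in>I. f i x) \<in> generated_algebra F"
  using assms
  by (induction I rule: infinite_finite_induct)
     (auto intro: generated_algebra.const generated_algebra.add)

text \<open>The converse of diagonalization, which lets K-stability be tested on every integer
  vector \<open>a\<close> of sum 0.\<close>

lemma one_parameter_subgroup_diagonal:
  fixes g h :: "complex^'n^'n"
  assumes "g \<in> SL" "h \<in> SL" and hg: "h ** g = mat 1" and a: "sum a UNIV = 0"
  shows "one_parameter_subgroup (diagonal_subgroup g a h)"
  unfolding one_parameter_subgroup_def diagonal_subgroup_def
proof (intro conjI ballI allI)
  fix t :: complex assume "t \<in> -{0}"
  then show "g ** diagonal_matrix (cocharacter a t) ** h \<in> SL"
    using assms cocharacter_in_unit_torus[of t a] by (simp add: SL_mult diagonal_matrix_in_SL)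
next
  fix s t :: complex
  have "cocharacter a (s * t) = cocharacter a s * cocharacter a t"
    by (simp add: cocharacter_def vec_eq_iff power_int_mult_distrib)
  moreover have "g ** diagonal_matrix (cocharacter a s) ** h **
      (g ** diagonal_matrix (cocharacter a t) ** h) =
    g ** diagonal_matrix (cocharacter a s) ** (h ** g) ** diagonal_matrix (cocharacter a t) ** h"
    by (simp only: matrix_mul_assoc)
  ultimately show "g ** diagonal_matrix (cocharacter a (s * t)) ** h =
      g ** diagonal_matrix (cocharacter a s) ** h ** (g ** diagonal_matrix (cocharacter a t) ** h)"
    by (simp add: hg diagonal_matrix_mult matrix_mul_assoc)
next
  fix i j
  define F where "F = {\<lambda>t::complex. t, inverse}"
  have powi: "(\<lambda>t. t powi k) \<in> generated_algebra F" for k :: int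
  proof -
    have "(\<lambda>t. t ^ n) \<in> generated_algebra F" "(\<lambda>t. inverse t ^ n) \<in> generated_algebra F" for n
      by (intro generated_algebra_power generated_algebra.gen; simp add: F_def)+
    then show ?thesis by (cases "0 \<le> k") (simp_all add: power_int_def)
  qed
  have entry: "(\<lambda>t. diagonal_matrix (cocharacter a t) $ k $ m) \<in> generated_algebra F" for k m
    by (cases "k = m")
       (simp_all add: diagonal_matrix_def cocharacter_def powi generated_algebra.const)
  have "(\<lambda>t. (g ** diagonal_matrix (cocharacter a t) ** h) $ i $ j) \<in> generated_algebra F"
    unfolding matrix_matrix_mult_def vec_lambda_beta
    by (intro generated_algebra_sum generated_algebra.mult generated_algebra.const entry)
  then show "restricts_from {\<lambda>t. t, inverse} (-{0})
      (\<lambda>t. (g ** diagonal_matrix (cocharacter a t) ** h) $ i $ j)"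
    unfolding restricts_from_def F_def
    by (intro bexI[of _ "\<lambda>t. (g ** diagonal_matrix (cocharacter a t) ** h) $ i $ j"]) simp_all
qed

text \<open>This puts the identity matrix under the same weight formula as \<open>v\<close> and
  \<open>w\<close>.\<close>

lemma gl_rational_representation:
  "rational_representation gl_scale (gl_act :: complex^'n^'n \<Rightarrow> complex^'n^'n \<Rightarrow> complex^'n^'n)"
proof -
  let ?s = "gl_scale :: complex \<Rightarrow> complex^'n^'n \<Rightarrow> complex^'n^'n"
  define U :: "'n \<Rightarrow> 'n \<Rightarrow> complex^'n^'n"
    where "U i j = (\<chi> k m. if k = i \<and> m = j then 1 else 0)" for i j
  have vs: "vector_space ?s"
    by unfold_locales (auto simp: gl_scale_def vec_eq_iff algebra_simps)
  interpret vector_space ?s by (rule vs)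
  have expand: "A = (\<Sum>i\<in>UNIV. \<Sum>j\<in>UNIV. ?s (A $ i $ j) (U i j))" for A
  proof -
    have "?s (A $ i $ j) (U i j) $ k $ m = (if m = j then if k = i then A $ i $ j else 0 else 0)"
      for i j k m
      by (simp add: gl_scale_def U_def)
    then have "(\<Sum>i\<in>UNIV. \<Sum>j\<in>UNIV. ?s (A $ i $ j) (U i j)) $ k $ m = A $ k $ m" for k m
      by simp
    then show ?thesis by (simp add: vec_eq_iff)
  qed
  define R where "R = (\<lambda>(i, j). U i j) ` UNIV"
  have "(\<Sum>i\<in>UNIV. \<Sum>j\<in>UNIV. ?s (A $ i $ j) (U i j)) \<in> span R" for A
    by (intro span_sum span_scale span_base) (auto simp: R_def)
  then have "A \<in> span R" for A by (subst expand[of A])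
  then have spanR: "span R = UNIV" by blast
  \<comment> \<open>A basis is picked out of the finite spanning set of matrix units instead of
    proving these independent.\<close>
  obtain B where B: "B \<subseteq> R" "independent B" "R \<subseteq> span B"
    using maximal_independent_subset by blast
  have "span B = UNIV" using span_minimal[OF B(3) subspace_span] spanR by blast
  moreover have "finite B" using B(1) by (rule finite_subset) (simp add: R_def)
  ultimately have fd: "\<exists>B. finite_dimensional_vector_space ?s B"
    using B(2) by (intro exI[of _ B]) unfold_locales
  have lin: "Vector_Spaces.linear ?s ?s (gl_act g)" for g
    unfolding Vector_Spaces.linear_iff using vs
    by (simp add: gl_act_def gl_scale_def vec_eq_iff matrix_matrix_mult_def distrib_left sum.distrib
        sum_distrib_left mult_ac)
  have reg: "regular_on SL (\<lambda>g. \<phi> (gl_act g A))" if \<phi>: "functional ?s \<phi>" for \<phi> A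
  proof -
    interpret \<phi>: Vector_Spaces.linear ?s "(*)" \<phi> by (rule \<phi>)
    have "\<phi> (gl_act g A) = (\<Sum>i\<in>UNIV. \<Sum>j\<in>UNIV. (\<Sum>k\<in>UNIV. g $ i $ k * A $ k $ j) * \<phi> (U i j))" for g
      by (subst expand[of "gl_act g A"])
         (simp only: \<phi>.sum \<phi>.scale, simp add: gl_act_def matrix_matrix_mult_def)
    moreover have "(\<lambda>g :: complex^'n^'n. \<Sum>i\<in>UNIV. \<Sum>j\<in>UNIV. (\<Sum>k\<in>UNIV. g $ i $ k * A $ k $ j) * \<phi> (U i j))
        \<in> generated_algebra matrix_coords"
      by (intro generated_algebra_sum generated_algebra.mult generated_algebra.const
          generated_algebra.gen) (auto simp: matrix_coords_def)
    ultimately show ?thesis unfolding restricts_from_def by fastforce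
  qed
  show ?thesis
    unfolding rational_representation_def
    using fd lin reg by (simp add: gl_act_def matrix_mul_assoc)
qed

section \<open>Uniform bounds\<close>

lemma pairing_diff: "pairing \<kappa> (a - b) = pairing \<kappa> a - pairing \<kappa> b"
  by (simp add: pairing_def right_diff_distrib sum_subtractf)

text \<open>As \<open>f\<close> is nonnegative, enlarging the constant only weakens the bound, so
  the sum of the finitely many constants works on every piece.\<close>

lemma finite_uniform_bound:
  fixes f h :: "'a \<Rightarrow> int"
  assumes "finite I" and cover: "\<And>a. P a \<Longrightarrow> \<exists>i\<in>I. C i a"
    and nonneg: "\<And>a. P a \<Longrightarrow> 0 \<le> f a"
    and bound: "\<And>i. i \<in> I \<Longrightarrow> \<exists>m::nat. \<forall>a. P a \<and> C i a \<longrightarrow> h a \<le> int m * f a"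
  shows "\<exists>m::nat. \<forall>a. P a \<longrightarrow> h a \<le> int m * f a"
proof -
  obtain m :: "_ \<Rightarrow> nat" where m: "\<And>i a. i \<in> I \<Longrightarrow> P a \<Longrightarrow> C i a \<Longrightarrow> h a \<le> int (m i) * f a"
    using bound by metis
  have "h a \<le> int (\<Sum>i\<in>I. m i) * f a" if a: "P a" for a
  proof -
    obtain i where i: "i \<in> I" "C i a" using cover[OF a] by blast
    have "m i \<le> (\<Sum>i\<in>I. m i)" using i(1) \<open>finite I\<close> by (intro member_le_sum) auto
    then have "int (m i) * f a \<le> int (\<Sum>i\<in>I. m i) * f a"
      using nonneg[OF a] by (intro mult_right_mono) (simp_all only: of_nat_le_iff)
    with m[OF i(1) a i(2)] show ?thesis by linarith
  qed
  then show ?thesis by blast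
qed

text \<open>Fixing a minimizer in each support cuts out a cone by finitely many linear inequalities;
  on it the three minima are additive in \<open>a\<close>, so \<open>additive_cone_bound\<close>
  applies.\<close>

lemma min_pairing_bound:
  fixes S1 S2 S3 :: "('n::finite \<Rightarrow> nat) set" and d :: int
  assumes fin: "finite S1" "finite S2" "finite S3"
    and ne: "S1 \<noteq> {}" "S2 \<noteq> {}" "S3 \<noteq> {}"
    and le: "\<And>a. sum a UNIV = 0 \<Longrightarrow> min_pairing S2 a \<le> min_pairing S1 a"
    and less: "\<And>a. sum a UNIV = 0 \<Longrightarrow> d * min_pairing S3 a < min_pairing S1 a \<Longrightarrow>
      min_pairing S2 a < min_pairing S1 a"
  shows "\<exists>m::nat. \<forall>a. sum a UNIV = 0 \<longrightarrow>
    min_pairing S1 a - d * min_pairing S3 a \<le> int m * (min_pairing S1 a - min_pairing S2 a)"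
proof -
  define minimal where "minimal S \<kappa> a \<longleftrightarrow> (\<forall>\<nu>\<in>S. 0 \<le> pairing \<nu> a - pairing \<kappa> a)"
    for S :: "('n \<Rightarrow> nat) set" and \<kappa> a
  have eq: "min_pairing S a = pairing \<kappa> a" if "finite S" "\<kappa> \<in> S" "minimal S \<kappa> a" for S \<kappa> a
    using that unfolding min_pairing_def minimal_def by (intro Min_eqI) auto
  have ex: "\<exists>\<kappa>\<in>S. minimal S \<kappa> a" if "finite S" "S \<noteq> {}" for S a
  proof -
    have "Min ((\<lambda>\<kappa>. pairing \<kappa> a) ` S) \<in> (\<lambda>\<kappa>. pairing \<kappa> a) ` S"
      using that by (intro Min_in) auto
    then obtain \<kappa> where "\<kappa> \<in> S" "Min ((\<lambda>\<kappa>. pairing \<kappa> a) ` S) = pairing \<kappa> a" by blast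
    moreover from this(2) have "pairing \<kappa> a \<le> pairing \<nu> a" if "\<nu> \<in> S" for \<nu>
      using \<open>finite S\<close> that by (metis Min_le finite_imageI imageI)
    ultimately show ?thesis by (auto simp: minimal_def)
  qed
  show ?thesis
  proof (rule finite_uniform_bound[where I = "S1 \<times> S2 \<times> S3" and
      C = "\<lambda>(\<kappa>1, \<kappa>2, \<kappa>3) a. minimal S1 \<kappa>1 a \<and> minimal S2 \<kappa>2 a \<and> minimal S3 \<kappa>3 a"])
    show "finite (S1 \<times> S2 \<times> S3)" using fin by simp
    show "\<exists>i\<in>S1 \<times> S2 \<times> S3. (\<lambda>(\<kappa>1, \<kappa>2, \<kappa>3) a. minimal S1 \<kappa>1 a \<and> minimal S2 \<kappa>2 a \<and> minimal S3 \<kappa>3 a) i a"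
      for a
      using ex[OF fin(1) ne(1), of a] ex[OF fin(2) ne(2), of a] ex[OF fin(3) ne(3), of a] by auto
    show "0 \<le> min_pairing S1 a - min_pairing S2 a" if "sum a UNIV = 0" for a
      using le[OF that] by simp
    fix i assume "i \<in> S1 \<times> S2 \<times> S3"
    then obtain \<kappa>1 \<kappa>2 \<kappa>3 where i: "i = (\<kappa>1, \<kappa>2, \<kappa>3)" and \<kappa>: "\<kappa>1 \<in> S1" "\<kappa>2 \<in> S2" "\<kappa>3 \<in> S3"
      by auto
    define difference where "difference = (\<lambda>(\<nu>, \<kappa>) a. pairing \<nu> a - pairing \<kappa> (a :: 'n \<Rightarrow> int))"
    \<comment> \<open>The inequalities saying that \<kappa>1, \<kappa>2 and \<kappa>3 are minimizers
      in their supports.\<close>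
    define Q where "Q = difference ` (S1 \<times> {\<kappa>1} \<union> S2 \<times> {\<kappa>2} \<union> S3 \<times> {\<kappa>3})"
    have Q: "(\<forall>q\<in>Q. 0 \<le> q a) \<longleftrightarrow> minimal S1 \<kappa>1 a \<and> minimal S2 \<kappa>2 a \<and> minimal S3 \<kappa>3 a" for a
      by (auto simp: Q_def minimal_def difference_def ball_Un)
    note eqs = eq[OF fin(1) \<kappa>(1)] eq[OF fin(2) \<kappa>(2)] eq[OF fin(3) \<kappa>(3)]
    have "\<exists>m::nat. \<forall>a\<in>{a. sum a UNIV = 0}. (\<forall>q\<in>Q. 0 \<le> q a) \<longrightarrow>
        pairing \<kappa>1 a - d * pairing \<kappa>3 a \<le> int m * (pairing \<kappa>1 a - pairing \<kappa>2 a)"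
    proof (rule additive_cone_bound[where f = "\<lambda>a. pairing \<kappa>1 a - pairing \<kappa>2 a" and
        h = "\<lambda>a. pairing \<kappa>1 a - d * pairing \<kappa>3 a"])
      show "a - b \<in> {a. sum a UNIV = 0}" if "a \<in> {a. sum a UNIV = 0}" "b \<in> {a. sum a UNIV = 0}"
        for a b :: "'n \<Rightarrow> int"
        using that by (simp add: sum_subtractf)
      show "finite Q" using fin by (simp add: Q_def)
      show "q (a - b) = q a - q b"
        if "q \<in> insert (\<lambda>a. pairing \<kappa>1 a - pairing \<kappa>2 a)
          (insert (\<lambda>a. pairing \<kappa>1 a - d * pairing \<kappa>3 a) Q)" for q a b
        using that by (auto simp: Q_def difference_def pairing_diff algebra_simps)
    next
      fix a :: "'n \<Rightarrow> int"
      assume a: "a \<in> {a. sum a UNIV = 0}" and "\<And>q. q \<in> Q \<Longrightarrow> 0 \<le> q a"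
      then have min: "minimal S1 \<kappa>1 a \<and> minimal S2 \<kappa>2 a \<and> minimal S3 \<kappa>3 a" using Q by blast
      show "0 \<le> pairing \<kappa>1 a - pairing \<kappa>2 a" using le[of a] a min eqs by simp
      show "0 < pairing \<kappa>1 a - pairing \<kappa>2 a" if "0 < pairing \<kappa>1 a - d * pairing \<kappa>3 a"
        using less[of a] a min eqs that by simp
    qed
    then obtain m :: nat where m: "\<And>a. sum a UNIV = 0 \<Longrightarrow>
        minimal S1 \<kappa>1 a \<and> minimal S2 \<kappa>2 a \<and> minimal S3 \<kappa>3 a \<Longrightarrow>
        pairing \<kappa>1 a - d * pairing \<kappa>3 a \<le> int m * (pairing \<kappa>1 a - pairing \<kappa>2 a)"
      unfolding Q by blast
    show "\<exists>m::nat. \<forall>a. sum a UNIV = 0 \<and>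
        (\<lambda>(\<kappa>1, \<kappa>2, \<kappa>3) a. minimal S1 \<kappa>1 a \<and> minimal S2 \<kappa>2 a \<and> minimal S3 \<kappa>3 a) i a \<longrightarrow>
        min_pairing S1 a - d * min_pairing S3 a \<le> int m * (min_pairing S1 a - min_pairing S2 a)"
      using m eqs by (intro exI[of _ m]) (simp add: i)
  qed
qed

theorem theorem1p2:
  fixes T :: "(complex^'n^'n) set"
    and sV :: "complex \<Rightarrow> 'v::ab_group_add \<Rightarrow> 'v" and actV :: "complex^'n^'n \<Rightarrow> 'v \<Rightarrow> 'v"
    and sW :: "complex \<Rightarrow> 'w::ab_group_add \<Rightarrow> 'w" and actW :: "complex^'n^'n \<Rightarrow> 'w \<Rightarrow> 'w"
    and v :: 'v and w :: 'w
  assumes "maximal_torus T"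
    and "rational_representation sV actV"
    and "rational_representation sW actW"
    and "v \<noteq> 0" and "w \<noteq> 0"
    and "K_stable T sV actV v sW actW w"
  shows "\<exists>m::int. 0 < m \<and> (\<forall>l. one_parameter_subgroup l \<longrightarrow>
    m * (weight sV actV l v - weight sW actW l w)
      \<ge> weight sV actV l v - rep_degree T sV actV * weight gl_scale gl_act l (mat 1))"
proof -
  define d where "d = rep_degree T sV actV"
  have I: "mat 1 \<noteq> (0 :: complex^'n^'n)" by (auto simp: vec_eq_iff mat_def)
  obtain K1 S1 where 1: "finite K1" "\<And>h. h \<in> SL \<Longrightarrow> S1 h \<subseteq> K1" "\<And>h. h \<in> SL \<Longrightarrow> S1 h \<noteq> {}"
    "\<And>g h a l. g \<in> SL \<Longrightarrow> h \<in> SL \<Longrightarrow> h ** g = mat 1 \<Longrightarrow> sum a UNIV = 0 \<Longrightarrow>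
      (\<And>t. t \<noteq> 0 \<Longrightarrow> l t = diagonal_subgroup g a h t) \<Longrightarrow>
      weight sV actV l v = min_pairing (S1 h) a"
    by (fact weight_eq_min_pairing[OF assms(2,4)])
  obtain K2 S2 where 2: "finite K2" "\<And>h. h \<in> SL \<Longrightarrow> S2 h \<subseteq> K2" "\<And>h. h \<in> SL \<Longrightarrow> S2 h \<noteq> {}"
    "\<And>g h a l. g \<in> SL \<Longrightarrow> h \<in> SL \<Longrightarrow> h ** g = mat 1 \<Longrightarrow> sum a UNIV = 0 \<Longrightarrow>
      (\<And>t. t \<noteq> 0 \<Longrightarrow> l t = diagonal_subgroup g a h t) \<Longrightarrow>
      weight sW actW l w = min_pairing (S2 h) a"
    by (fact weight_eq_min_pairing[OF assms(3,5)])
  obtain K3 S3 where 3: "finite K3" "\<And>h. h \<in> SL \<Longrightarrow> S3 h \<subseteq> K3" "\<And>h. h \<in> SL \<Longrightarrow> S3 h \<noteq> {}"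
    "\<And>(g :: complex^'n^'n) h a l. g \<in> SL \<Longrightarrow> h \<in> SL \<Longrightarrow> h ** g = mat 1 \<Longrightarrow> sum a UNIV = 0 \<Longrightarrow>
      (\<And>t. t \<noteq> 0 \<Longrightarrow> l t = diagonal_subgroup g a h t) \<Longrightarrow>
      weight gl_scale gl_act l (mat 1) = min_pairing (S3 h) a"
    by (fact weight_eq_min_pairing[OF gl_rational_representation I])
  have semistable: "weight sW actW l w \<le> weight sV actV l v" if "one_parameter_subgroup l" for l
    using assms(6) that by (simp add: K_stable_def K_semistable_def)
  have stable: "weight sW actW l w < weight sV actV l v"
    if "one_parameter_subgroup l" "d * weight gl_scale gl_act l (mat 1) < weight sV actV l v" for l
    using assms(6) that by (simp add: K_stable_def d_def)
  \<comment> \<open>For fixed \<open>h\<close> each \<open>a\<close> of sum 0 comes from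
    \<open>diagonal_subgroup g a h\<close>, so K-stability supplies the hypotheses of
    \<open>min_pairing_bound\<close>. The constant may still depend on \<open>h\<close>.\<close>
  have bound: "\<exists>m::nat. \<forall>a. sum a UNIV = 0 \<longrightarrow>
      min_pairing (S1 h) a - d * min_pairing (S3 h) a \<le> int m * (min_pairing (S1 h) a - min_pairing (S2 h) a)"
    if h: "h \<in> SL" for h
  proof -
    obtain g where g: "g \<in> SL" "h ** g = mat 1" using SL_inverse[OF h] by blast
    have weights: "weight sV actV (diagonal_subgroup g a h) v = min_pairing (S1 h) a"
      "weight sW actW (diagonal_subgroup g a h) w = min_pairing (S2 h) a"
      "weight gl_scale gl_act (diagonal_subgroup g a h) (mat 1) = min_pairing (S3 h) a"
      if "sum a UNIV = 0" for a
      using 1(4)[OF g(1) h g(2) that] 2(4)[OF g(1) h g(2) that] 3(4)[OF g(1) h g(2) that]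
      by simp_all
    have "finite (S1 h)" "finite (S2 h)" "finite (S3 h)"
      using finite_subset[OF 1(2)[OF h] 1(1)] finite_subset[OF 2(2)[OF h] 2(1)]
        finite_subset[OF 3(2)[OF h] 3(1)] .
    then show ?thesis
    proof (rule min_pairing_bound)
      show "S1 h \<noteq> {}" "S2 h \<noteq> {}" "S3 h \<noteq> {}" using 1(3)[OF h] 2(3)[OF h] 3(3)[OF h] .
      show "min_pairing (S2 h) a \<le> min_pairing (S1 h) a" if "sum a UNIV = 0" for a
        using semistable[OF one_parameter_subgroup_diagonal[OF g(1) h g(2) that]] weights[OF that]
        by simp
      show "min_pairing (S2 h) a < min_pairing (S1 h) a"
        if "sum a UNIV = 0" "d * min_pairing (S3 h) a < min_pairing (S1 h) a" for a
        using stable[OF one_parameter_subgroup_diagonal[OF g(1) h g(2) that(1)]] weights[OF that(1)] that(2)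
        by simp
    qed
  qed
  \<comment> \<open>The bound for \<open>h\<close> involves only this triple of supports, so
    finitely many constants suffice for the infinitely many \<open>h\<close>.\<close>
  define supports where "supports = (\<lambda>h. (S1 h, S2 h, S3 h)) ` SL"
  have "finite supports"
  proof (rule finite_subset)
    show "supports \<subseteq> Pow K1 \<times> Pow K2 \<times> Pow K3"
      unfolding supports_def using 1(2) 2(2) 3(2) by (intro image_subsetI) simp
    show "finite (Pow K1 \<times> Pow K2 \<times> Pow K3)" using 1(1) 2(1) 3(1) by simp
  qed
  then have "\<exists>m::nat. \<forall>l. one_parameter_subgroup l \<longrightarrow>
      weight sV actV l v - d * weight gl_scale gl_act l (mat 1)
        \<le> int m * (weight sV actV l v - weight sW actW l w)"
  \<comment> \<open>A piece consists of the subgroups whose three weights are read off one triple at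
    a common \<open>a\<close>; it forgets \<open>g\<close> and \<open>h\<close>, so any
    representative of the triple may supply the constant.\<close>
  proof (rule finite_uniform_bound[where C = "\<lambda>(R1, R2, R3) l. \<exists>a. sum a UNIV = 0 \<and>
      weight sV actV l v = min_pairing R1 a \<and> weight sW actW l w = min_pairing R2 a \<and>
      weight gl_scale gl_act l (mat 1) = min_pairing R3 a"])
    fix l :: "complex \<Rightarrow> complex^'n^'n"
    assume l: "one_parameter_subgroup l"
    obtain g h a where g: "g \<in> SL" "h \<in> SL" "h ** g = mat 1" "sum a UNIV = 0"
      and lt: "\<And>t. t \<noteq> 0 \<Longrightarrow> l t = diagonal_subgroup g a h t"
      by (fact one_parameter_subgroup_diagonalizable[OF l])
    then show "\<exists>i\<in>supports. (\<lambda>(R1, R2, R3) l. \<exists>a. sum a UNIV = 0 \<and>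
        weight sV actV l v = min_pairing R1 a \<and> weight sW actW l w = min_pairing R2 a \<and>
        weight gl_scale gl_act l (mat 1) = min_pairing R3 a) i l"
      using g 1(4)[OF g lt] 2(4)[OF g lt] 3(4)[OF g lt]
      by (intro bexI[of _ "(S1 h, S2 h, S3 h)"]) (auto simp: supports_def)
    show "0 \<le> weight sV actV l v - weight sW actW l w" using semistable[OF l] by simp
  next
    fix i assume "i \<in> supports"
    then obtain h where h: "h \<in> SL" "i = (S1 h, S2 h, S3 h)" by (auto simp: supports_def)
    obtain m :: nat where m: "\<And>a. sum a UNIV = 0 \<Longrightarrow>
        min_pairing (S1 h) a - d * min_pairing (S3 h) a \<le> int m * (min_pairing (S1 h) a - min_pairing (S2 h) a)"
      using bound[OF h(1)] by blast
    then show "\<exists>m::nat. \<forall>l. one_parameter_subgroup l \<and> (\<lambda>(R1, R2, R3) l. \<exists>a. sum a UNIV = 0 \<and>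
        weight sV actV l v = min_pairing R1 a \<and> weight sW actW l w = min_pairing R2 a \<and>
        weight gl_scale gl_act l (mat 1) = min_pairing R3 a) i l \<longrightarrow>
        weight sV actV l v - d * weight gl_scale gl_act l (mat 1)
          \<le> int m * (weight sV actV l v - weight sW actW l w)"
      by (intro exI[of _ m]) (auto simp: h(2))
  qed
  then obtain m :: nat where m: "\<And>l. one_parameter_subgroup l \<Longrightarrow>
      weight sV actV l v - d * weight gl_scale gl_act l (mat 1)
        \<le> int m * (weight sV actV l v - weight sW actW l w)" by blast
  \<comment> \<open>The constant found may be 0; semistability allows replacing it by its
    successor.\<close>
  have "weight sV actV l v - d * weight gl_scale gl_act l (mat 1)
      \<le> int (Suc m) * (weight sV actV l v - weight sW actW l w)" if "one_parameter_subgroup l" for l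
    using m[OF that] semistable[OF that] by (simp add: distrib_right)
  then show ?thesis
    unfolding d_def by (intro exI[of _ "int (Suc m)"]) auto
qed

end
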